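(* Let $A\in C^2(\mathbb{R}^3,\mathbb{R}^3)$ and $m>0$. For every $u\in C^\infty_c(\mathbb{R}^3,\mathbb{C})$ it holds $$\lim_{s\nearrow 1}(-\Delta+m^2)^s_A u=(-\Delta_A+m^2)u\quad\text{in }\mathbb{R}^3,$$ i.e. for every $x\in\mathbb{R}^3$, $(-\Delta+m^2)^s_A u(x)\to -\Delta_A u(x)+m^2u(x)$ as $s\nearrow1$.
   Context: For $s\in(0,1)$, $C_s:=\dfrac{s\,2^{\frac{2s-1}{2}}}{\pi^{3/2}\,\Gamma(1-s)}$, where $\Gamma$ is the Gamma function. $\mathcal{K}_\nu$ is the modified Bessel function (also called MacDonald function, or modified Bessel function of the second/third kind) of order $\nu$: $\mathcal{K}_\nu(\zeta)=\frac12\left(\frac{\zeta}{2}\right)^\nu\int_0^{+\infty}e^{-\frac{\zeta^2}{4t}-t}t^{-1-\nu}\,dt$ for $\zeta>0$. With $B^c_\varepsilon(x)=\{y\in\mathbb{R}^3:|x-y|\ge\varepsilon\}$, the operator is $$(-\Delta+m^2)^s_A u(x):=C_s m^{\frac{3+2s}{2}}\lim_{\varepsilon\searrow0}\int_{B^c_\varepsilon(x)}\frac{u(x)-e^{i(x-y)\cdot A\left(\frac{x+y}{2}\right)}u(y)}{|x-y|^{\frac{3+2s}{2}}}\,\mathcal{K}_{\frac{3+2s}{2}}(m|x-y|)\,dy+m^{2s}u(x),\quad x\in\mathbb{R}^3.$$ The magnetic Laplacian is $-\Delta_A u:=-(\nabla-iA)^2u=-\Delta u+iu\,\mathrm{div}A+2iA\cdot\nabla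 u+|A|^2u$. *)

theory Defs
  imports "HOL-Analysis.Analysis"
begin

text \<open>
  On a finite-dimensional space, a function is \<open>C\<^sup>k\<close> on the whole space iff it is \<open>k\<close> times
  differentiable and all its iterated directional derivatives up to order \<open>k\<close> are continuous.
\<close>

primrec Ck :: "nat \<Rightarrow> ('a::euclidean_space \<Rightarrow> 'b::real_normed_vector) \<Rightarrow> bool" where
  "Ck 0 f \<longleftrightarrow> continuous_on UNIV f"
| "Ck (Suc k) f \<longleftrightarrow>
     (\<forall>x. f differentiable (at x)) \<and> (\<forall>v. Ck k (\<lambda>x. frechet_derivative f (at x) v))"

definition test_function :: "('a::euclidean_space \<Rightarrow> 'b::real_normed_vector) \<Rightarrow> bool" where
  "test_function u \<longleftrightarrow> (\<forall>k. Ck k u) \<and> compact (closure {x. u x \<noteq> 0})"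

definition partial_deriv ::
  "'n::finite \<Rightarrow> (real^'n \<Rightarrow> 'b::real_normed_vector) \<Rightarrow> real^'n \<Rightarrow> 'b" where
  "partial_deriv j f x = frechet_derivative f (at x) (axis j 1)"

text \<open>The \<open>j\<close>-th component of \<open>\<nabla> - iA\<close>.\<close>

definition cov_deriv ::
  "(real^3 \<Rightarrow> real^3) \<Rightarrow> 3 \<Rightarrow> (real^3 \<Rightarrow> complex) \<Rightarrow> real^3 \<Rightarrow> complex" where
  "cov_deriv A j u x = partial_deriv j u x - \<i> * complex_of_real (A x $ j) * u x"

definition magnetic_laplacian ::
  "(real^3 \<Rightarrow> real^3) \<Rightarrow> (real^3 \<Rightarrow> complex) \<Rightarrow> real^3 \<Rightarrow> complex" where
  "magnetic_laplacian A u x = (\<Sum>j\<in>UNIV. cov_deriv A j (cov_deriv A j u) x)"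

lemma partial_deriv_eq:
  assumes "(f has_derivative f') (at x)"
  shows "partial_deriv j f x = f' (axis j 1)"
  using frechet_derivative_at[OF assms] by (simp add: partial_deriv_def)

text \<open>The expanded form of \<open>-\<Delta>\<^sub>A u = -(\<nabla> - iA)\<^sup>2 u\<close>.\<close>

lemma magnetic_laplacian_expand:
  assumes A: "Ck 1 A" and u: "Ck 2 u"
  shows "- magnetic_laplacian A u x =
      - (\<Sum>j\<in>UNIV. partial_deriv j (partial_deriv j u) x)
      + \<i> * u x * complex_of_real (\<Sum>j\<in>UNIV. partial_deriv j (\<lambda>y. A y $ j) x)
      + 2 * \<i> * (\<Sum>j\<in>UNIV. complex_of_real (A x $ j) * partial_deriv j u x)
      + complex_of_real ((norm (A x))\<^sup>2) * u x"
proof -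
  have dA: "(A has_derivative frechet_derivative A (at x)) (at x)"
    using A by (simp add: frechet_derivative_works)
  have dAj: "((\<lambda>y. A y $ j) has_derivative (\<lambda>h. frechet_derivative A (at x) h $ j)) (at x)" for j
    by (rule bounded_linear.has_derivative[OF bounded_linear_vec_nth dA])
  have du: "(u has_derivative frechet_derivative u (at x)) (at x)"
    using u by (simp add: frechet_derivative_works numeral_2_eq_2)
  have dpu: "(partial_deriv j u has_derivative frechet_derivative (partial_deriv j u) (at x)) (at x)"
    for j
    using u unfolding partial_deriv_def frechet_derivative_works[symmetric]
    by (simp add: numeral_2_eq_2)
  have cov: "partial_deriv j (cov_deriv A j u) x = partial_deriv j (partial_deriv j u) x
      - \<i> * (complex_of_real (A x $ j) * partial_deriv j u x
             + complex_of_real (partial_deriv j (\<lambda>y. A y $ j) x) * u x)" for j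
  proof -
    have "(cov_deriv A j u has_derivative (\<lambda>h. frechet_derivative (partial_deriv j u) (at x) h
      - \<i> * (complex_of_real (A x $ j) * frechet_derivative u (at x) h
             + complex_of_real (frechet_derivative A (at x) h $ j) * u x))) (at x)"
      unfolding cov_deriv_def mult.assoc
      by (intro has_derivative_diff has_derivative_mult_right has_derivative_mult
          has_derivative_of_real dpu dAj du)
    from partial_deriv_eq[OF this, of j] show ?thesis
      by (simp only: partial_deriv_eq[OF dAj] partial_deriv_eq[OF du] partial_deriv_eq[OF dpu])
  qed
  have nrm: "complex_of_real ((norm (A x))\<^sup>2) = (\<Sum>j\<in>UNIV. complex_of_real (A x $ j) * complex_of_real (A x $ j))"
    by (simp add: power2_norm_eq_inner inner_vec_def)
  have covcov: "cov_deriv A j (cov_deriv A j u) x = partial_deriv j (partial_deriv j u) x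
      - \<i> * u x * complex_of_real (partial_deriv j (\<lambda>y. A y $ j) x)
      - 2 * \<i> * (complex_of_real (A x $ j) * partial_deriv j u x)
      - complex_of_real (A x $ j) * complex_of_real (A x $ j) * u x" for j
    by (subst cov_deriv_def[of A j "cov_deriv A j u"], subst cov)
       (simp add: cov_deriv_def algebra_simps)
  show ?thesis
    unfolding magnetic_laplacian_def nrm covcov
    by (simp add: sum_subtractf sum.distrib sum_distrib_left sum_distrib_right algebra_simps)
qed

definition C_const :: "real \<Rightarrow> real" where
  "C_const s = s * 2 powr ((2 * s - 1) / 2) / (pi powr (3 / 2) * Gamma (1 - s))"

definition bessel_K :: "real \<Rightarrow> real \<Rightarrow> real" where
  "bessel_K \<nu> \<zeta> = 1 / 2 * (\<zeta> / 2) powr \<nu> *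
     (LINT t:{0<..}|lborel. exp (- (\<zeta>\<^sup>2 / (4 * t)) - t) * t powr (- 1 - \<nu>))"

text \<open>
  The operator \<open>(-\<Delta> + m\<^sup>2)\<^sup>s\<^sub>A\<close>, meant for \<open>0 < s < 1\<close> and \<open>m > 0\<close>. For \<open>C\<^sup>2\<close> potentials and
  test functions \<open>u\<close> the truncated integrals are absolutely convergent and the limit exists.
\<close>

definition frac_magnetic ::
  "real \<Rightarrow> real \<Rightarrow> (real^3 \<Rightarrow> real^3) \<Rightarrow> (real^3 \<Rightarrow> complex) \<Rightarrow> real^3 \<Rightarrow> complex" where
  "frac_magnetic s m A u x =
     complex_of_real (C_const s * m powr ((3 + 2 * s) / 2)) *
       Lim (at_right 0) (\<lambda>\<epsilon>. LINT y:{y. \<epsilon> \<le> norm (x - y)}|lborel.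
         (u x - exp (\<i> * complex_of_real ((x - y) \<bullet> A ((1 / 2) *\<^sub>R (x + y)))) * u y)
           / complex_of_real (norm (x - y) powr ((3 + 2 * s) / 2))
           * complex_of_real (bessel_K ((3 + 2 * s) / 2) (m * norm (x - y))))
     + complex_of_real (m powr (2 * s)) * u x"

end

theory Submission
  imports Defs "HOL-Probability.Distributions"
begin

text \<open>
  Fix \<open>x\<close> and put \<open>f h = exp (- \<i> h \<bullet> A (x + h / 2)) u (x + h)\<close>, so that \<open>f 0 = u x\<close>. Substituting
  \<open>y = x + h\<close> turns the truncated integrals of \<open>(-\<Delta> + m\<^sup>2)\<^sup>s\<^sub>A u x\<close> into integrals of
  \<open>f 0 - f h\<close> against the radial kernel
  \<open>\<kappa>\<^sub>s h = C\<^sub>s m\<^bsup>\<nu>\<^esup> K\<^sub>\<nu> (m |h|) / |h|\<^bsup>\<nu>\<^esup>\<close>, \<open>\<nu> = (3 + 2 s) / 2\<close>. Three facts give the limit.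

  First, \<open>\<kappa>\<^sub>s\<close> is even, so \<open>f 0 - f h\<close> may be replaced by its even part
  \<open>\<psi> h = f 0 - (f h + f (- h)) / 2\<close>, which is \<open>O(|h|\<^sup>2)\<close>. Since \<open>\<kappa>\<^sub>s\<close> has a finite second moment,
  dominated convergence removes the truncation (lemma \<open>symmetrised_principal_value\<close>), and the singular
  integral becomes the absolutely convergent \<open>\<integral> \<psi> \<kappa>\<^sub>s\<close>.

  Secondly, the integral representation of \<open>K\<^sub>\<nu>\<close> exhibits \<open>\<kappa>\<^sub>s\<close> as a mixture of centred Gaussians with weight
  \<open>exp (- t) t\<^bsup>- 1 - \<nu>\<^esup> dt\<close>. By Tonelli its moments reduce to Gaussian moments and Gamma integrals
  (lemma \<open>nn_integral_frac_kernel_moment\<close>): in each coordinate the second moment is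
  \<open>2 s m\<^bsup>2 s - 2\<^esup>\<close>, which tends to \<open>2\<close>, and the fourth moment is \<open>12 s (1 - s) m\<^bsup>2 s - 4\<^esup>\<close>, which tends
  to \<open>0\<close>. The fourth moment controls the part of the second moment carried by \<open>|h| \<ge> \<delta>\<close>, so the measures
  \<open>|h|\<^sup>2 \<kappa>\<^sub>s h dh\<close> concentrate at the origin.

  Thirdly, \<open>\<psi> h = - (\<Sum>a b. c a b h\<^sub>a h\<^sub>b) + o(|h|\<^sup>2)\<close>, where \<open>c\<close> comes from second-order expansions of \<open>u\<close> and
  of the phase (lemma \<open>gauge_translate_expansion\<close>). By reflection symmetry mixed second moments of \<open>\<kappa>\<^sub>s\<close>
  vanish, and by concentration only the quadratic part of \<open>\<psi>\<close> matters in the limit, so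
  \<open>\<integral> \<psi> \<kappa>\<^sub>s\<close> tends to \<open>- 2 (\<Sum>b. c b b)\<close> (lemma \<open>tendsto_integral_concentrating_kernels\<close>). Evaluating the
  phase at the midpoint \<open>x + h / 2\<close> produces exactly the coefficient of \<open>div A\<close> for which twice the trace of
  \<open>c\<close> is the magnetic Laplacian of \<open>u\<close> at \<open>x\<close>.
\<close>

section \<open>Gaussian moments\<close>

lemma nn_integral_even_moment_gaussian_1d:
  fixes a :: real
  assumes a: "a > 0"
  shows "(\<integral>\<^sup>+x. ennreal (x ^ (2 * k) * exp (- (a * x\<^sup>2))) \<partial>lborel)
    = ennreal (sqrt pi * (fact (2 * k) / (2 ^ (2 * k) * fact k)) * a powr (- 1 / 2 - real k))"
proof -
  have base: "has_bochner_integral lborel (\<lambda>x::real. exp (- x\<^sup>2) * x ^ (2 * k))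
      (sqrt pi * (fact (2 * k) / (2 ^ (2 * k) * fact k)))"
    using has_bochner_integral_even_function[OF gaussian_moment_even_pos[of k]] by simp
  have "has_bochner_integral lborel (\<lambda>x::real. exp (- (sqrt a * x)\<^sup>2) * (sqrt a * x) ^ (2 * k))
      ((sqrt pi * (fact (2 * k) / (2 ^ (2 * k) * fact k))) /\<^sub>R \<bar>sqrt a\<bar>)"
    using lborel_has_bochner_integral_real_affine_iff[of "sqrt a" _ _ 0, THEN iffD1, OF _ base] a by simp
  then have "has_bochner_integral lborel
      (\<lambda>x::real. exp (- (sqrt a * x)\<^sup>2) * (sqrt a * x) ^ (2 * k) * a powr (- real k))
      (((sqrt pi * (fact (2 * k) / (2 ^ (2 * k) * fact k))) /\<^sub>R \<bar>sqrt a\<bar>) * a powr (- real k))"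
    by (rule has_bochner_integral_mult_left)
  also have "(\<lambda>x::real. exp (- (sqrt a * x)\<^sup>2) * (sqrt a * x) ^ (2 * k) * a powr (- real k))
      = (\<lambda>x. x ^ (2 * k) * exp (- (a * x\<^sup>2)))"
    using a by (auto simp: fun_eq_iff power_mult power_mult_distrib powr_minus powr_realpow)
  also have "((sqrt pi * (fact (2 * k) / (2 ^ (2 * k) * fact k))) /\<^sub>R \<bar>sqrt a\<bar>) * a powr (- real k)
      = sqrt pi * (fact (2 * k) / (2 ^ (2 * k) * fact k)) * a powr (- 1 / 2 - real k)"
  proof -
    have "a powr (- 1 / 2 - real k) = inverse (sqrt a) * a powr (- real k)"
      using a by (simp only: diff_conv_add_uminus powr_add powr_half_sqrt[symmetric] powr_minus[symmetric]) simp
    moreover have "\<bar>sqrt a\<bar> = sqrt a" using a by simp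
    ultimately show ?thesis by (simp only: real_scaleR_def mult_ac)
  qed
  finally have *: "has_bochner_integral lborel (\<lambda>x. x ^ (2 * k) * exp (- (a * x\<^sup>2)))
      (sqrt pi * (fact (2 * k) / (2 ^ (2 * k) * fact k)) * a powr (- 1 / 2 - real k))" .
  then have int: "integrable lborel (\<lambda>x. x ^ (2 * k) * exp (- (a * x\<^sup>2)))"
    by (rule integrable.intros)
  show ?thesis
    unfolding nn_integral_eq_integral[OF int, simplified] has_bochner_integral_integral_eq[OF *] ..
qed

lemma power2_norm_eq_sum_inner:
  fixes h :: "'a::euclidean_space"
  shows "(norm h)\<^sup>2 = (\<Sum>b\<in>Basis. (h \<bullet> b)\<^sup>2)"
  unfolding power2_norm_eq_inner euclidean_inner[of h h] by (simp add: power2_eq_square)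

text \<open>
  The Gaussian factorises over the coordinates, and all factors but one are zeroth moments; the exponent
  \<open>e c\<close> in the proof selects the coordinate that carries the power.
\<close>

lemma nn_integral_even_moment_gaussian:
  fixes a :: real and b :: "'a::euclidean_space"
  assumes a: "a > 0" and b: "b \<in> Basis"
  shows "(\<integral>\<^sup>+h. ennreal ((h \<bullet> b) ^ (2 * k) * exp (- (a * (norm h)\<^sup>2))) \<partial>lborel)
    = ennreal (sqrt pi ^ DIM('a) * (fact (2 * k) / (2 ^ (2 * k) * fact k)) * a powr (- real DIM('a) / 2 - real k))"
proof -
  define e where "e c = (if c = b then k else 0)" for c
  have "(\<integral>\<^sup>+h. ennreal ((h \<bullet> b) ^ (2 * k) * exp (- (a * (norm h)\<^sup>2))) \<partial>lborel)
      = (\<integral>\<^sup>+h. (\<Prod>c\<in>Basis. ennreal ((h \<bullet> c) ^ (2 * e c) * exp (- (a * (h \<bullet> c)\<^sup>2)))) \<partial>(lborel :: 'a measure))"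
  proof (intro nn_integral_cong)
    fix h :: 'a
    have "(\<Prod>c\<in>Basis. (h \<bullet> c) ^ (2 * e c)) = (\<Prod>c\<in>Basis. if c = b then (h \<bullet> b) ^ (2 * k) else 1)"
      by (intro prod.cong) (auto simp: e_def)
    also have "\<dots> = (h \<bullet> b) ^ (2 * k)"
      using b by (simp add: prod.delta)
    finally have 1: "(\<Prod>c\<in>Basis. (h \<bullet> c) ^ (2 * e c)) = (h \<bullet> b) ^ (2 * k)" .
    have "(norm h)\<^sup>2 = (\<Sum>c\<in>Basis. (h \<bullet> c)\<^sup>2)"
      by (rule power2_norm_eq_sum_inner)
    then have 2: "(\<Prod>c\<in>Basis. exp (- (a * (h \<bullet> c)\<^sup>2))) = exp (- (a * (norm h)\<^sup>2))"
      by (simp add: exp_sum[symmetric] sum_negf sum_distrib_left)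
    show "ennreal ((h \<bullet> b) ^ (2 * k) * exp (- (a * (norm h)\<^sup>2)))
        = (\<Prod>c\<in>Basis. ennreal ((h \<bullet> c) ^ (2 * e c) * exp (- (a * (h \<bullet> c)\<^sup>2))))"
      by (subst prod_ennreal) (auto simp: prod.distrib 1 2)
  qed
  also have "\<dots> = (\<Prod>c\<in>(Basis :: 'a set). \<integral>\<^sup>+x. ennreal (x ^ (2 * e c) * exp (- (a * x\<^sup>2))) \<partial>lborel)"
    by (subst nn_integral_lborel_prod) auto
  also have "\<dots> = (\<Prod>c\<in>(Basis :: 'a set). ennreal (sqrt pi * a powr (- 1 / 2)
      * (if c = b then (fact (2 * k) / (2 ^ (2 * k) * fact k)) * a powr (- real k) else 1)))"
  proof (intro prod.cong refl)
    fix c :: 'a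
    have "a powr (- 1 / 2 - real k) = a powr (- 1 / 2) * a powr (- real k)"
      by (simp only: diff_conv_add_uminus powr_add)
    then show "(\<integral>\<^sup>+x. ennreal (x ^ (2 * e c) * exp (- (a * x\<^sup>2))) \<partial>lborel) = ennreal (sqrt pi * a powr (- 1 / 2)
      * (if c = b then (fact (2 * k) / (2 ^ (2 * k) * fact k)) * a powr (- real k) else 1))"
      by (subst nn_integral_even_moment_gaussian_1d[OF a]) (simp add: e_def)
  qed
  also have "\<dots> = ennreal (\<Prod>c\<in>(Basis :: 'a set). sqrt pi * a powr (- 1 / 2)
      * (if c = b then (fact (2 * k) / (2 ^ (2 * k) * fact k)) * a powr (- real k) else 1))"
    by (intro prod_ennreal) auto
  also have "(\<Prod>c\<in>(Basis :: 'a set). sqrt pi * a powr (- 1 / 2)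
      * (if c = b then (fact (2 * k) / (2 ^ (2 * k) * fact k)) * a powr (- real k) else 1))
     = sqrt pi ^ DIM('a) * (a powr (- 1 / 2)) ^ DIM('a)
       * ((fact (2 * k) / (2 ^ (2 * k) * fact k)) * a powr (- real k))"
    using b by (simp add: prod.distrib prod.delta power_mult_distrib)
  also have "(a powr (- 1 / 2)) ^ DIM('a) = a powr (- real DIM('a) / 2)"
    using a by (simp add: powr_power)
  finally show ?thesis
    by (simp only: diff_conv_add_uminus powr_add mult_ac)
qed

section \<open>Integrals against radial kernels\<close>

text \<open>
  Sign changes of coordinates preserve Lebesgue measure. Changing all signs yields the symmetrisation
  of the principal value, changing a single one kills the mixed second moments.
\<close>

lemma distr_lborel_reflection:
  fixes \<sigma> :: "'a::euclidean_space \<Rightarrow> real"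
  assumes \<sigma>: "\<And>b. b \<in> Basis \<Longrightarrow> \<bar>\<sigma> b\<bar> = 1"
  shows "distr lborel borel (\<lambda>h. \<Sum>b\<in>Basis. (\<sigma> b * (h \<bullet> b)) *\<^sub>R b) = (lborel :: 'a measure)"
proof -
  have "lborel = density (distr lborel borel (\<lambda>h::'a. 0 + (\<Sum>b\<in>Basis. (\<sigma> b * (h \<bullet> b)) *\<^sub>R b)))
      (\<lambda>_. \<Prod>b\<in>Basis. \<bar>\<sigma> b\<bar>)"
    using \<sigma> by (intro lborel_affine_euclidean) fastforce+
  then show ?thesis by (simp add: \<sigma> density_1 one_ennreal_def[symmetric])
qed

lemma integral_lborel_reflection:
  fixes \<sigma> :: "'a::euclidean_space \<Rightarrow> real" and f :: "'a \<Rightarrow> 'b::{banach, second_countable_topology}"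
  assumes \<sigma>: "\<And>b. b \<in> Basis \<Longrightarrow> \<bar>\<sigma> b\<bar> = 1" and f: "f \<in> borel_measurable borel"
  shows "(LINT h|lborel. f (\<Sum>b\<in>Basis. (\<sigma> b * (h \<bullet> b)) *\<^sub>R b)) = (LINT h|lborel. f h)"
proof -
  have "(LINT h|lborel. f h) = (LINT h|distr lborel borel (\<lambda>h. \<Sum>b\<in>Basis. (\<sigma> b * (h \<bullet> b)) *\<^sub>R b). f h)"
    by (simp only: distr_lborel_reflection[OF \<sigma>])
  also have "\<dots> = (LINT h|lborel. f (\<Sum>b\<in>Basis. (\<sigma> b * (h \<bullet> b)) *\<^sub>R b))"
    using f by (intro integral_distr) auto
  finally show ?thesis ..
qed

lemma integral_lborel_uminus:
  fixes f :: "'a::euclidean_space \<Rightarrow> 'b::{banach, second_countable_topology}"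
  assumes f: "f \<in> borel_measurable borel"
  shows "(LINT h|lborel. f (- h)) = (LINT h|lborel. f h)"
proof -
  have "(\<Sum>b\<in>Basis. (- 1 * (h \<bullet> b)) *\<^sub>R b) = - h" for h :: 'a
    by (simp add: sum_negf euclidean_representation)
  then show ?thesis
    using integral_lborel_reflection[of "\<lambda>_::'a. - 1" f, OF _ f] by simp
qed

lemma norm_le_sum_inner_power4:
  fixes h :: "'a::euclidean_space"
  shows "norm h ^ 4 \<le> DIM('a) * (\<Sum>b\<in>Basis. (h \<bullet> b) ^ 4)"
proof -
  have "norm h ^ 4 = ((norm h)\<^sup>2)\<^sup>2" by simp
  also have "(norm h)\<^sup>2 = (\<Sum>b\<in>Basis. (h \<bullet> b)\<^sup>2)"
    by (rule power2_norm_eq_sum_inner)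
  also have "(\<Sum>b\<in>Basis. (h \<bullet> b)\<^sup>2)\<^sup>2 \<le> DIM('a) * (\<Sum>b\<in>(Basis::'a set). ((h \<bullet> b)\<^sup>2)\<^sup>2)"
    using sum_squared_le_sum_of_squares[of "\<lambda>b. (h \<bullet> b)\<^sup>2" Basis] by (simp add: mult.commute)
  finally show ?thesis by simp
qed

text \<open>
  Integrating against a radial kernel only sees the trace of the coefficient matrix, so iterated directional
  derivatives can be entered as they come, unsymmetrised.
\<close>

definition quad_form :: "('a::euclidean_space \<Rightarrow> 'a \<Rightarrow> complex) \<Rightarrow> 'a \<Rightarrow> complex" where
  "quad_form c h = (\<Sum>a\<in>Basis. \<Sum>b\<in>Basis. of_real ((h \<bullet> a) * (h \<bullet> b)) * c a b)"

lemma measurable_quad_form [measurable]: "quad_form c \<in> borel_measurable borel"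
  unfolding quad_form_def[abs_def] by measurable

lemma norm_quad_form_le: "norm (quad_form c h) \<le> (\<Sum>a\<in>Basis. \<Sum>b\<in>Basis. norm (c a b)) * (norm h)\<^sup>2"
proof -
  have "norm (quad_form c h) \<le> (\<Sum>a\<in>Basis. \<Sum>b\<in>Basis. (norm h)\<^sup>2 * norm (c a b))"
    unfolding quad_form_def
  proof (intro sum_norm_le)
    fix a b :: 'a assume "a \<in> Basis" "b \<in> Basis"
    then have "\<bar>h \<bullet> a\<bar> * \<bar>h \<bullet> b\<bar> \<le> norm h * norm h"
      by (intro mult_mono Basis_le_norm) auto
    then show "norm (of_real ((h \<bullet> a) * (h \<bullet> b)) * c a b) \<le> (norm h)\<^sup>2 * norm (c a b)"
      by (simp only: norm_mult norm_of_real abs_mult power2_eq_square mult_right_mono norm_ge_zero)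
  qed
  also have "\<dots> = (\<Sum>a\<in>Basis. \<Sum>b\<in>Basis. norm (c a b)) * (norm h)\<^sup>2"
    by (simp add: sum_distrib_left sum_distrib_right mult.commute)
  finally show ?thesis .
qed

text \<open>
  A Levy-type kernel: it may have infinite mass at the origin, and the second moment is what makes
  integrals of functions of size \<open>O(|h|\<^sup>2)\<close> converge.
\<close>

locale radial_kernel =
  fixes \<kappa> :: "'a::euclidean_space \<Rightarrow> real"
  assumes measurable_kernel [measurable]: "\<kappa> \<in> borel_measurable borel"
    and kernel_nonneg: "\<kappa> h \<ge> 0"
    and radial: "norm h = norm h' \<Longrightarrow> \<kappa> h = \<kappa> h'"
    and integrable_second_moment: "integrable lborel (\<lambda>h. (norm h)\<^sup>2 * \<kappa> h)"
begin

lemma integrable_quadratic_bound: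
  fixes f :: "'a \<Rightarrow> 'b::{banach, second_countable_topology, real_normed_div_algebra}"
  assumes [measurable]: "f \<in> borel_measurable borel" and f: "\<And>h. norm (f h) \<le> C * (norm h)\<^sup>2"
  shows "integrable lborel (\<lambda>h. f h * of_real (\<kappa> h))"
proof (rule Bochner_Integration.integrable_bound[OF integrable_mult_right[OF integrable_second_moment, of C]])
  show "AE h in lborel. norm (f h * of_real (\<kappa> h)) \<le> norm (C * ((norm h)\<^sup>2 * \<kappa> h))"
  proof (rule AE_I2)
    fix h
    have "norm (f h * of_real (\<kappa> h)) = norm (f h) * \<kappa> h"
      using kernel_nonneg by (simp add: norm_mult)
    also have "\<dots> \<le> C * (norm h)\<^sup>2 * \<kappa> h"
      by (intro mult_right_mono f kernel_nonneg)
    also have "\<dots> \<le> norm (C * ((norm h)\<^sup>2 * \<kappa> h))"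
      by (simp only: real_norm_def mult.assoc abs_ge_self)
    finally show "norm (f h * of_real (\<kappa> h)) \<le> norm (C * ((norm h)\<^sup>2 * \<kappa> h))" .
  qed
qed measurable

lemma integrable_inner_mult:
  assumes "a \<in> Basis" "b \<in> Basis"
  shows "integrable lborel (\<lambda>h. (h \<bullet> a) * (h \<bullet> b) * \<kappa> h)"
proof -
  have "norm ((h \<bullet> a) * (h \<bullet> b)) \<le> 1 * (norm h)\<^sup>2" for h
    using assms by (simp add: abs_mult power2_eq_square mult_mono Basis_le_norm)
  from integrable_quadratic_bound[OF _ this] show ?thesis by simp
qed

lemma integral_off_diagonal:
  assumes ab: "a \<in> Basis" "b \<in> Basis" "a \<noteq> b"
  shows "(LINT h|lborel. (h \<bullet> a) * (h \<bullet> b) * \<kappa> h) = 0"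
proof -
  define R where "R h = (\<Sum>c\<in>Basis. ((if c = a then - 1 else 1) * (h \<bullet> c)) *\<^sub>R c)" for h :: 'a
  have R: "R h \<bullet> c = (if c = a then - 1 else 1) * (h \<bullet> c)" if "c \<in> Basis" for h c
    unfolding R_def using that by simp
  have "norm (R h) = norm h" for h
    unfolding norm_eq_sqrt_inner euclidean_inner[of "R h" "R h"] euclidean_inner[of h h]
    by (intro arg_cong[where f = sqrt] sum.cong) (auto simp: R)
  then have \<kappa>: "\<kappa> (R h) = \<kappa> h" for h by (intro radial)
  have "(LINT h|lborel. (h \<bullet> a) * (h \<bullet> b) * \<kappa> h) = (LINT h|lborel. (R h \<bullet> a) * (R h \<bullet> b) * \<kappa> (R h))"
    unfolding R_def
    by (rule integral_lborel_reflection[symmetric, of "\<lambda>c. if c = a then - 1 else 1"]) auto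
  also have "\<dots> = - (LINT h|lborel. (h \<bullet> a) * (h \<bullet> b) * \<kappa> h)"
    using ab by (simp add: R \<kappa>)
  finally show ?thesis by simp
qed

text \<open>
  The mixed second moments vanish by reflection, so only the diagonal coefficients survive.
\<close>

lemma integral_quad_form:
  "(LINT h|lborel. quad_form c h * of_real (\<kappa> h)) = (\<Sum>b\<in>Basis. of_real (LINT h|lborel. (h \<bullet> b)\<^sup>2 * \<kappa> h) * c b b)"
proof -
  have eq: "quad_form c h * of_real (\<kappa> h) = (\<Sum>a\<in>Basis. \<Sum>b\<in>Basis. of_real ((h \<bullet> a) * (h \<bullet> b) * \<kappa> h) * c a b)" for h
    unfolding quad_form_def sum_distrib_right by (intro sum.cong refl) simp
  have int: "integrable lborel (\<lambda>h. of_real ((h \<bullet> a) * (h \<bullet> b) * \<kappa> h) * c a b)" if "a \<in> Basis" "b \<in> Basis" for a b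
    by (intro integrable_mult_left integrable_of_real integrable_inner_mult that)
  have "(LINT h|lborel. quad_form c h * of_real (\<kappa> h))
      = (\<Sum>a\<in>Basis. LINT h|lborel. (\<Sum>b\<in>Basis. of_real ((h \<bullet> a) * (h \<bullet> b) * \<kappa> h) * c a b))"
    unfolding eq by (intro Bochner_Integration.integral_sum Bochner_Integration.integrable_sum int)
  also have "\<dots> = (\<Sum>a\<in>Basis. \<Sum>b\<in>Basis. LINT h|lborel. of_real ((h \<bullet> a) * (h \<bullet> b) * \<kappa> h) * c a b)"
    by (intro sum.cong refl Bochner_Integration.integral_sum int)
  also have "\<dots> = (\<Sum>a\<in>Basis. \<Sum>b\<in>Basis. of_real (LINT h|lborel. (h \<bullet> a) * (h \<bullet> b) * \<kappa> h) * c a b)"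
    by (simp only: integral_mult_left_zero integral_complex_of_real)
  also have "\<dots> = (\<Sum>a\<in>Basis. \<Sum>b\<in>Basis. if a = b then of_real (LINT h|lborel. (h \<bullet> b)\<^sup>2 * \<kappa> h) * c b b else 0)"
    by (intro sum.cong refl) (auto simp: integral_off_diagonal power2_eq_square)
  also have "\<dots> = (\<Sum>b\<in>Basis. of_real (LINT h|lborel. (h \<bullet> b)\<^sup>2 * \<kappa> h) * c b b)"
    by (subst sum.swap) (simp add: sum.delta)
  finally show ?thesis .
qed

text \<open>
  On \<open>{h. \<epsilon> \<le> norm h}\<close> the kernel is integrable, because there \<open>1 \<le> |h|\<^sup>2 / \<epsilon>\<^sup>2\<close>, so averaging the integrand
  with its reflection is legitimate. The averaged integrand has the \<open>\<epsilon>\<close>-independent majorant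
  \<open>C |h|\<^sup>2 \<kappa> h\<close>, and dominated convergence applies as \<open>\<epsilon> \<rightarrow> 0\<close>.
\<close>

lemma symmetrised_principal_value:
  fixes f :: "'a \<Rightarrow> complex"
  defines "\<psi> \<equiv> \<lambda>h. f 0 - (f h + f (- h)) / 2"
  assumes f [measurable]: "f \<in> borel_measurable borel" and M: "\<And>h. norm (f h) \<le> M"
    and C: "\<And>h. norm (\<psi> h) \<le> C * (norm h)\<^sup>2"
  shows "((\<lambda>\<epsilon>. LINT h:{h. \<epsilon> \<le> norm h}|lborel. (f 0 - f h) * of_real (\<kappa> h))
    \<longlongrightarrow> (LINT h|lborel. \<psi> h * of_real (\<kappa> h))) (at_right 0)"
proof -
  have \<psi> [measurable]: "\<psi> \<in> borel_measurable borel"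
    unfolding \<psi>_def by measurable
  have symm: "(LINT h:{h. \<epsilon> \<le> norm h}|lborel. (f 0 - f h) * of_real (\<kappa> h))
      = (LINT h|lborel. indicator {h. \<epsilon> \<le> norm h} h *\<^sub>R (\<psi> h * of_real (\<kappa> h)))" if \<epsilon>: "\<epsilon> > 0" for \<epsilon>
  proof -
    define g where "g h = (indicat_real {h. \<epsilon> \<le> norm h} h *\<^sub>R (f 0 - f h))" for h
    have [measurable]: "g \<in> borel_measurable borel"
      unfolding g_def by measurable
    have g_le: "norm (g h) \<le> 2 * M / \<epsilon>\<^sup>2 * (norm h)\<^sup>2" for h
    proof (cases "\<epsilon> \<le> norm h")
      case True
      have M0: "M \<ge> 0" using M[of 0] norm_ge_zero[of "f 0"] by linarith
      have "1 \<le> (norm h)\<^sup>2 / \<epsilon>\<^sup>2"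
        using True \<epsilon> by (simp add: power_mono)
      then have "2 * M * 1 \<le> 2 * M * ((norm h)\<^sup>2 / \<epsilon>\<^sup>2)"
        using M0 by (intro mult_left_mono) auto
      moreover have "norm (f 0 - f h) \<le> 2 * M"
        using norm_triangle_ineq4[of "f 0" "f h"] M[of 0] M[of h] by linarith
      ultimately show ?thesis using True by (simp add: g_def)
    next
      case False
      then show ?thesis
        using order_trans[OF norm_ge_zero M[of 0]] by (simp add: g_def)
    qed
    then have int: "integrable lborel (\<lambda>h. g h * of_real (\<kappa> h))"
      by (rule integrable_quadratic_bound[rotated]) measurable
    have int': "integrable lborel (\<lambda>h. g (- h) * of_real (\<kappa> h))"
      using g_le[of "- h" for h] by (intro integrable_quadratic_bound[where C = "2 * M / \<epsilon>\<^sup>2"]) simp_all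
    have "(LINT h|lborel. g h * of_real (\<kappa> h)) = (LINT h|lborel. g (- h) * of_real (\<kappa> (- h)))"
      by (rule integral_lborel_uminus[symmetric]) measurable
    also have "\<dots> = (LINT h|lborel. g (- h) * of_real (\<kappa> h))"
      using radial[of "- h" h for h] by simp
    finally have "(LINT h|lborel. g h * of_real (\<kappa> h))
        = ((LINT h|lborel. g h * of_real (\<kappa> h)) + (LINT h|lborel. g (- h) * of_real (\<kappa> h))) / 2"
      by simp
    also have "\<dots> = (LINT h|lborel. (g h * of_real (\<kappa> h) + g (- h) * of_real (\<kappa> h)) / 2)"
      by (simp only: Bochner_Integration.integral_add[OF int int'] integral_divide_zero)
    also have "(\<lambda>h. (g h * of_real (\<kappa> h) + g (- h) * of_real (\<kappa> h)) / 2)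
        = (\<lambda>h. indicator {h. \<epsilon> \<le> norm h} h *\<^sub>R (\<psi> h * of_real (\<kappa> h)))"
      by (auto simp: fun_eq_iff g_def \<psi>_def indicator_def field_simps)
    finally show ?thesis
      unfolding set_lebesgue_integral_def g_def by simp
  qed
  show ?thesis
  proof (rule tendsto_at_right_sequentially[of 0 1])
    fix S :: "nat \<Rightarrow> real"
    assume S: "\<And>n. 0 < S n" "S \<longlonglongrightarrow> 0"
    have "(\<lambda>n. LINT h|lborel. indicator {h. S n \<le> norm h} h *\<^sub>R (\<psi> h * of_real (\<kappa> h)))
        \<longlonglongrightarrow> (LINT h|lborel. \<psi> h * of_real (\<kappa> h))"
    proof (rule integral_dominated_convergence[where w = "\<lambda>h. C * ((norm h)\<^sup>2 * \<kappa> h)"])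
      show "integrable lborel (\<lambda>h. C * ((norm h)\<^sup>2 * \<kappa> h))"
        by (intro integrable_mult_right integrable_second_moment)
      show "AE h in lborel. (\<lambda>n. indicator {h. S n \<le> norm h} h *\<^sub>R (\<psi> h * of_real (\<kappa> h)))
          \<longlonglongrightarrow> \<psi> h * of_real (\<kappa> h)"
        using AE_lborel_singleton[of 0]
      proof eventually_elim
        fix h :: 'a assume "h \<noteq> 0"
        then have "\<forall>\<^sub>F n in sequentially. S n < norm h"
          using S(2) by (intro order_tendstoD) auto
        then have "\<forall>\<^sub>F n in sequentially. indicator {h. S n \<le> norm h} h *\<^sub>R (\<psi> h * of_real (\<kappa> h)) = \<psi> h * of_real (\<kappa> h)"
          by eventually_elim auto
        then show "(\<lambda>n. indicator {h. S n \<le> norm h} h *\<^sub>R (\<psi> h * of_real (\<kappa> h))) \<longlonglongrightarrow> \<psi> h * of_real (\<kappa> h)"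
          by (rule tendsto_eventually)
      qed
      show "AE h in lborel. norm (indicator {h. S n \<le> norm h} h *\<^sub>R (\<psi> h * of_real (\<kappa> h))) \<le> C * ((norm h)\<^sup>2 * \<kappa> h)" for n
      proof (rule AE_I2)
        fix h
        have "norm (indicator {h. S n \<le> norm h} h *\<^sub>R (\<psi> h * of_real (\<kappa> h))) \<le> norm (\<psi> h) * \<kappa> h"
          using kernel_nonneg[of h] by (simp add: indicator_def norm_mult)
        also have "\<dots> \<le> C * (norm h)\<^sup>2 * \<kappa> h"
          by (intro mult_right_mono C kernel_nonneg)
        finally show "norm (indicator {h. S n \<le> norm h} h *\<^sub>R (\<psi> h * of_real (\<kappa> h))) \<le> C * ((norm h)\<^sup>2 * \<kappa> h)"
          by (simp only: mult.assoc)
      qed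
    qed measurable
    then show "(\<lambda>n. LINT h:{h. S n \<le> norm h}|lborel. (f 0 - f h) * of_real (\<kappa> h)) \<longlonglongrightarrow> (LINT h|lborel. \<psi> h * of_real (\<kappa> h))"
      by (simp only: symm[OF S(1)])
  qed simp
qed

end

section \<open>Kernels concentrating at the origin\<close>

context radial_kernel begin

text \<open>
  The sum on the left is the integral of \<open>\<psi> + quad_form c\<close>, whose pointwise bound integrates to second and
  fourth moments. This is the quantitative form of concentration: in the application \<open>\<eta>\<close> is small and the
  fourth moments tend to zero, while \<open>K\<close> may be large.
\<close>

lemma norm_integral_add_trace_le:
  fixes \<psi> :: "'a \<Rightarrow> complex"
  assumes [measurable]: "\<psi> \<in> borel_measurable borel"
    and C: "\<And>h. norm (\<psi> h) \<le> C * (norm h)\<^sup>2"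
    and dev: "\<And>h. norm (\<psi> h + quad_form c h) \<le> \<eta> * (norm h)\<^sup>2 + K * norm h ^ 4"
    and K: "K \<ge> 0"
    and int4: "\<And>b. b \<in> Basis \<Longrightarrow> integrable lborel (\<lambda>h. (h \<bullet> b) ^ 4 * \<kappa> h)"
  shows "norm ((LINT h|lborel. \<psi> h * of_real (\<kappa> h)) + (\<Sum>b\<in>Basis. of_real (LINT h|lborel. (h \<bullet> b)\<^sup>2 * \<kappa> h) * c b b))
    \<le> \<eta> * (\<Sum>b\<in>Basis. LINT h|lborel. (h \<bullet> b)\<^sup>2 * \<kappa> h)
      + K * DIM('a) * (\<Sum>b\<in>Basis. LINT h|lborel. (h \<bullet> b) ^ 4 * \<kappa> h)"
proof -
  let ?w = "\<lambda>h. \<eta> * (\<Sum>b\<in>Basis. (h \<bullet> b)\<^sup>2 * \<kappa> h) + K * DIM('a) * (\<Sum>b\<in>Basis. (h \<bullet> b) ^ 4 * \<kappa> h)"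
  have int2: "integrable lborel (\<lambda>h. (h \<bullet> b)\<^sup>2 * \<kappa> h)" if "b \<in> Basis" for b
    using integrable_inner_mult[OF that that] by (simp add: power2_eq_square)
  have int\<psi>: "integrable lborel (\<lambda>h. \<psi> h * of_real (\<kappa> h))"
    by (rule integrable_quadratic_bound[OF _ C]) measurable
  have intq: "integrable lborel (\<lambda>h. quad_form c h * of_real (\<kappa> h))"
    by (rule integrable_quadratic_bound[OF _ norm_quad_form_le]) measurable
  have intw: "integrable lborel ?w"
    by (intro Bochner_Integration.integrable_add integrable_mult_right Bochner_Integration.integrable_sum int2 int4)
  have "(LINT h|lborel. \<psi> h * of_real (\<kappa> h)) + (\<Sum>b\<in>Basis. of_real (LINT h|lborel. (h \<bullet> b)\<^sup>2 * \<kappa> h) * c b b)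
      = (LINT h|lborel. \<psi> h * of_real (\<kappa> h) + quad_form c h * of_real (\<kappa> h))"
    by (simp only: integral_quad_form[symmetric] Bochner_Integration.integral_add[OF int\<psi> intq])
  also have "norm \<dots> \<le> (LINT h|lborel. norm (\<psi> h * of_real (\<kappa> h) + quad_form c h * of_real (\<kappa> h)))"
    by (rule integral_norm_bound)
  also have "\<dots> \<le> (LINT h|lborel. ?w h)"
  proof (rule integral_mono[OF _ intw])
    show "integrable lborel (\<lambda>h. norm (\<psi> h * of_real (\<kappa> h) + quad_form c h * of_real (\<kappa> h)))"
      by (intro integrable_norm Bochner_Integration.integrable_add int\<psi> intq)
    fix h :: 'a
    have sq: "(norm h)\<^sup>2 = (\<Sum>b\<in>Basis. (h \<bullet> b)\<^sup>2)"
      by (rule power2_norm_eq_sum_inner)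
    have "norm (\<psi> h * of_real (\<kappa> h) + quad_form c h * of_real (\<kappa> h)) = norm ((\<psi> h + quad_form c h) * of_real (\<kappa> h))"
      by (simp only: distrib_right)
    also have "\<dots> = norm (\<psi> h + quad_form c h) * \<kappa> h"
      using kernel_nonneg[of h] by (simp add: norm_mult)
    also have "\<dots> \<le> (\<eta> * (norm h)\<^sup>2 + K * norm h ^ 4) * \<kappa> h"
      by (intro mult_right_mono dev kernel_nonneg)
    also have "\<dots> \<le> (\<eta> * (norm h)\<^sup>2 + K * (DIM('a) * (\<Sum>b\<in>Basis. (h \<bullet> b) ^ 4))) * \<kappa> h"
      by (intro mult_right_mono add_left_mono mult_left_mono K kernel_nonneg norm_le_sum_inner_power4)
    also have "\<dots> = ?w h"
      unfolding sq by (simp add: sum_distrib_left sum_distrib_right distrib_right mult.assoc)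
    finally show "norm (\<psi> h * of_real (\<kappa> h) + quad_form c h * of_real (\<kappa> h)) \<le> ?w h" .
  qed
  also have "\<dots> = \<eta> * (\<Sum>b\<in>Basis. LINT h|lborel. (h \<bullet> b)\<^sup>2 * \<kappa> h)
      + K * DIM('a) * (\<Sum>b\<in>Basis. LINT h|lborel. (h \<bullet> b) ^ 4 * \<kappa> h)"
    by (subst Bochner_Integration.integral_add)
      (simp_all only: integral_mult_right_zero Bochner_Integration.integral_sum int2 int4
        Bochner_Integration.integrable_sum integrable_mult_right)
  finally show ?thesis .
qed

end

text \<open>
  A local expansion of a bounded function becomes a global bound: inside a small ball the expansion itself
  is used, and outside that ball constants and \<open>|h|\<^sup>2\<close> are dominated by multiples of \<open>|h|\<^sup>2\<close> or \<open>|h|\<^sup>4\<close>.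
\<close>

lemma quadratic_expansion_bounds:
  fixes \<psi> :: "'a::euclidean_space \<Rightarrow> complex"
  assumes o: "(\<lambda>h. \<psi> h + quad_form c h) \<in> o[at 0](\<lambda>h. of_real (norm h) ^ 2)"
    and zero: "\<psi> 0 = 0" and B: "\<And>h. norm (\<psi> h) \<le> B"
  shows quadratic_expansion_imp_quadratic_bound: "\<exists>C. \<forall>h. norm (\<psi> h) \<le> C * (norm h)\<^sup>2"
    and quadratic_expansion_global: "\<eta> > 0 \<Longrightarrow> \<exists>K\<ge>0. \<forall>h. norm (\<psi> h + quad_form c h) \<le> \<eta> * (norm h)\<^sup>2 + K * norm h ^ 4"
proof -
  define Q where "Q = (\<Sum>a\<in>Basis. \<Sum>b\<in>Basis. norm (c a b))"
  have Q: "norm (quad_form c h) \<le> Q * (norm h)\<^sup>2" for h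
    unfolding Q_def by (rule norm_quad_form_le)
  have Q0: "Q \<ge> 0" unfolding Q_def by (intro sum_nonneg) auto
  have B0: "B \<ge> 0" using order_trans[OF norm_ge_zero B[of 0]] .
  have loc: "\<exists>\<delta>>0. \<forall>h. norm h < \<delta> \<longrightarrow> norm (\<psi> h + quad_form c h) \<le> \<eta> * (norm h)\<^sup>2" if \<eta>: "\<eta> > 0" for \<eta>
  proof -
    have "\<forall>\<^sub>F h in at 0. norm (\<psi> h + quad_form c h) \<le> \<eta> * (norm h)\<^sup>2"
      using landau_o.smallD[OF o \<eta>] by (simp add: norm_power)
    then obtain \<delta> where \<delta>: "\<delta> > 0" "\<And>h. h \<noteq> 0 \<Longrightarrow> norm h < \<delta> \<Longrightarrow> norm (\<psi> h + quad_form c h) \<le> \<eta> * (norm h)\<^sup>2"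
      unfolding eventually_at by auto
    then have "norm (\<psi> h + quad_form c h) \<le> \<eta> * (norm h)\<^sup>2" if "norm h < \<delta>" for h
      using that zero Q[of 0] by (cases "h = 0") auto
    with \<delta>(1) show ?thesis by blast
  qed
  show "\<exists>C. \<forall>h. norm (\<psi> h) \<le> C * (norm h)\<^sup>2"
  proof -
    obtain \<delta> where \<delta>: "\<delta> > 0" "\<And>h. norm h < \<delta> \<Longrightarrow> norm (\<psi> h + quad_form c h) \<le> 1 * (norm h)\<^sup>2"
      using loc[of 1] by auto
    have "norm (\<psi> h) \<le> (1 + Q + B / \<delta>\<^sup>2) * (norm h)\<^sup>2" for h
    proof (cases "norm h < \<delta>")
      case True
      have "norm (\<psi> h) \<le> norm (\<psi> h + quad_form c h) + norm (quad_form c h)"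
        by (metis add_diff_cancel_right' norm_triangle_ineq4)
      also have "\<dots> \<le> 1 * (norm h)\<^sup>2 + Q * (norm h)\<^sup>2"
        by (intro add_mono \<delta>(2) True Q)
      also have "\<dots> \<le> (1 + Q + B / \<delta>\<^sup>2) * (norm h)\<^sup>2"
        using B0 by (simp add: distrib_right)
      finally show ?thesis .
    next
      case False
      then have "1 \<le> (norm h)\<^sup>2 / \<delta>\<^sup>2"
        using \<delta>(1) by (simp add: power_mono)
      then have "B * 1 \<le> B * ((norm h)\<^sup>2 / \<delta>\<^sup>2)"
        using B0 by (intro mult_left_mono)
      moreover have "0 \<le> (1 + Q) * (norm h)\<^sup>2" using Q0 by simp
      ultimately show ?thesis
        using B[of h] by (simp add: distrib_right)
    qed
    then show ?thesis by blast
  qed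
  show "\<exists>K\<ge>0. \<forall>h. norm (\<psi> h + quad_form c h) \<le> \<eta> * (norm h)\<^sup>2 + K * norm h ^ 4" if \<eta>: "\<eta> > 0"
  proof -
    obtain \<delta> where \<delta>: "\<delta> > 0" "\<And>h. norm h < \<delta> \<Longrightarrow> norm (\<psi> h + quad_form c h) \<le> \<eta> * (norm h)\<^sup>2"
      using loc[OF \<eta>] by auto
    define K where "K = B / \<delta> ^ 4 + Q / \<delta>\<^sup>2"
    have K: "K \<ge> 0" using B0 Q0 \<delta>(1) by (simp add: K_def)
    have "norm (\<psi> h + quad_form c h) \<le> \<eta> * (norm h)\<^sup>2 + K * norm h ^ 4" for h
    proof (cases "norm h < \<delta>")
      case True
      then show ?thesis using \<delta>(2)[OF True] K by (simp add: add_increasing2)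
    next
      case False
      have 1: "1 \<le> (norm h)\<^sup>2 / \<delta>\<^sup>2"
        using False \<delta>(1) by (simp add: power_mono)
      have 2: "1 \<le> norm h ^ 4 / \<delta> ^ 4"
        using False \<delta>(1) by (simp add: power_mono)
      have "norm (\<psi> h + quad_form c h) \<le> B + Q * (norm h)\<^sup>2"
        using norm_triangle_ineq[of "\<psi> h" "quad_form c h"] B[of h] Q[of h] by linarith
      also have "\<dots> \<le> B * (norm h ^ 4 / \<delta> ^ 4) + Q * ((norm h)\<^sup>2 * ((norm h)\<^sup>2 / \<delta>\<^sup>2))"
        using mult_left_mono[OF 2 B0] mult_left_mono[OF mult_left_mono[OF 1, of "(norm h)\<^sup>2"] Q0] by simp
      also have "\<dots> = K * norm h ^ 4"
        by (simp add: K_def distrib_right power2_eq_square power4_eq_xxxx)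
      also have "\<dots> \<le> \<eta> * (norm h)\<^sup>2 + K * norm h ^ 4" using \<eta> by simp
      finally show ?thesis .
    qed
    with K show ?thesis by blast
  qed
qed

text \<open>
  Kernels whose second moments converge and whose fourth moments vanish in the limit act like
  second-order differential operators: they read off the trace of the quadratic part of \<open>\<psi>\<close> at the origin.
\<close>

lemma tendsto_integral_concentrating_kernels:
  fixes \<kappa> :: "'s \<Rightarrow> 'a::euclidean_space \<Rightarrow> real" and \<psi> :: "'a \<Rightarrow> complex"
  assumes kern: "\<forall>\<^sub>F s in F. radial_kernel (\<kappa> s)"
    and M2: "\<And>b. b \<in> Basis \<Longrightarrow> ((\<lambda>s. LINT h|lborel. (h \<bullet> b)\<^sup>2 * \<kappa> s h) \<longlongrightarrow> \<sigma>) F"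
    and int4: "\<And>b. b \<in> Basis \<Longrightarrow> \<forall>\<^sub>F s in F. integrable lborel (\<lambda>h. (h \<bullet> b) ^ 4 * \<kappa> s h)"
    and M4: "\<And>b. b \<in> Basis \<Longrightarrow> ((\<lambda>s. LINT h|lborel. (h \<bullet> b) ^ 4 * \<kappa> s h) \<longlongrightarrow> 0) F"
    and \<psi>: "\<psi> \<in> borel_measurable borel" "\<psi> 0 = 0" "\<And>h. norm (\<psi> h) \<le> B"
    and o: "(\<lambda>h. \<psi> h + quad_form c h) \<in> o[at 0](\<lambda>h. of_real (norm h) ^ 2)"
  shows "((\<lambda>s. LINT h|lborel. \<psi> h * of_real (\<kappa> s h)) \<longlongrightarrow> - (of_real \<sigma> * (\<Sum>b\<in>Basis. c b b))) F"
proof -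
  define X where "X s = (LINT h|lborel. \<psi> h * of_real (\<kappa> s h))" for s
  define Y where "Y s = (\<Sum>b\<in>Basis. of_real (LINT h|lborel. (h \<bullet> b)\<^sup>2 * \<kappa> s h) * c b b)" for s
  have Y: "(Y \<longlongrightarrow> (\<Sum>b\<in>Basis. of_real \<sigma> * c b b)) F"
    unfolding Y_def by (intro tendsto_intros M2)
  obtain C where C: "\<And>h. norm (\<psi> h) \<le> C * (norm h)\<^sup>2"
    using quadratic_expansion_imp_quadratic_bound[OF o \<psi>(2,3)] by blast
  have int4': "\<forall>\<^sub>F s in F. \<forall>b\<in>(Basis :: 'a set). integrable lborel (\<lambda>h. (h \<bullet> b) ^ 4 * \<kappa> s h)"
    using int4 by (intro eventually_ball_finite) auto
  have "((\<lambda>s. X s + Y s) \<longlongrightarrow> 0) F"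
  proof (rule tendstoI)
    fix e :: real assume e: "e > 0"
    \<comment> \<open>In the limit the second moments sum to \<open>DIM('a) * \<sigma>\<close>; the \<open>+ 1\<close> makes the bound strict, also for \<open>\<sigma> = 0\<close>.\<close>
    define \<eta> where "\<eta> = e / (DIM('a) * \<bar>\<sigma>\<bar> + 1)"
    have pos: "real DIM('a) * \<bar>\<sigma>\<bar> + 1 > 0" by (intro add_nonneg_pos) auto
    have \<eta>: "\<eta> > 0" using e pos by (simp add: \<eta>_def)
    obtain K where K: "K \<ge> 0" "\<And>h. norm (\<psi> h + quad_form c h) \<le> \<eta> * (norm h)\<^sup>2 + K * norm h ^ 4"
      using quadratic_expansion_global[OF o \<psi>(2,3) \<eta>] by blast
    let ?r = "\<lambda>s. \<eta> * (\<Sum>b\<in>(Basis :: 'a set). LINT h|lborel. (h \<bullet> b)\<^sup>2 * \<kappa> s h)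
      + K * DIM('a) * (\<Sum>b\<in>(Basis :: 'a set). LINT h|lborel. (h \<bullet> b) ^ 4 * \<kappa> s h)"
    have "(?r \<longlongrightarrow> \<eta> * (\<Sum>b\<in>(Basis :: 'a set). \<sigma>) + K * DIM('a) * (\<Sum>b\<in>(Basis :: 'a set). 0)) F"
      by (intro tendsto_intros M2 M4)
    moreover have "\<eta> * (\<Sum>b\<in>(Basis :: 'a set). \<sigma>) + K * DIM('a) * (\<Sum>b\<in>(Basis :: 'a set). 0) < e"
    proof -
      have "\<eta> * (DIM('a) * \<sigma>) \<le> \<eta> * (DIM('a) * \<bar>\<sigma>\<bar>)"
        using \<eta> by (intro mult_left_mono) auto
      also have "\<dots> < \<eta> * (DIM('a) * \<bar>\<sigma>\<bar> + 1)"
        using \<eta> by simp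
      also have "\<dots> = e" using pos by (simp add: \<eta>_def)
      finally show ?thesis by simp
    qed
    ultimately have "\<forall>\<^sub>F s in F. ?r s < e" by (rule order_tendstoD)
    then show "\<forall>\<^sub>F s in F. dist (X s + Y s) 0 < e"
      using kern int4'
    proof eventually_elim
      case (elim s)
      interpret radial_kernel "\<kappa> s" by (rule elim(2))
      have "norm (X s + Y s) \<le> ?r s"
        unfolding X_def Y_def using elim(3)
        by (intro norm_integral_add_trace_le[OF \<psi>(1) C K(2) K(1)]) auto
      with elim(1) show ?case by (simp only: dist_norm diff_zero order_le_less_trans)
    qed
  qed
  then have "((\<lambda>s. (X s + Y s) - Y s) \<longlongrightarrow> 0 - (\<Sum>b\<in>Basis. of_real \<sigma> * c b b)) F"
    by (intro tendsto_diff Y)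
  then show ?thesis by (simp add: X_def sum_distrib_left)
qed

section \<open>Moments of the Bessel kernel\<close>

lemma borel_measurable_bessel_K [measurable]: "bessel_K \<nu> \<in> borel_measurable borel"
  unfolding bessel_K_def[abs_def] set_lebesgue_integral_def by measurable

lemma bessel_K_nonneg: "bessel_K \<nu> \<zeta> \<ge> 0"
  unfolding bessel_K_def set_lebesgue_integral_def
  by (intro mult_nonneg_nonneg integral_nonneg_AE) auto

lemma nn_integral_Gamma_real:
  assumes "p > (0::real)"
  shows "(\<integral>\<^sup>+t. ennreal (indicator {0<..} t * (t powr (p - 1) * exp (- t))) \<partial>lborel) = ennreal (Gamma p)"
  unfolding Gamma_conv_nn_integral_real[OF assms]
proof (rule nn_integral_cong_AE)
  show "AE t in lborel. ennreal (indicator {0<..} t * (t powr (p - 1) * exp (- t)))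
      = ennreal (indicator {0..} t * t powr (p - 1) / exp t)"
    using AE_lborel_singleton[of "0::real"]
    by eventually_elim (auto simp: indicator_def exp_minus divide_inverse)
qed

lemma power_div_fact_le_exp:
  assumes "y \<ge> (0::real)"
  shows "y ^ n / fact n \<le> exp y"
proof -
  have "(\<Sum>k\<in>{n}. y ^ k /\<^sub>R fact k) \<le> (\<Sum>k. y ^ k /\<^sub>R fact k)"
    using assms by (intro sum_le_suminf summable_exp_generic) auto
  then show ?thesis by (simp add: exp_def divide_inverse mult.commute)
qed

text \<open>
  The factor \<open>exp (- \<zeta>\<^sup>2 / (4 t))\<close> is \<open>O(t ^ n)\<close> for every \<open>n\<close>, which beats the singular power at \<open>t = 0\<close> and
  leaves a convergent Gamma integral. Integrability matters because it identifies the Bochner integral in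
  the definition of \<open>bessel_K\<close>, which would default to \<open>0\<close>, with the nonnegative one.
\<close>

lemma bessel_K_integrand_integrable:
  fixes \<zeta> :: real
  assumes "\<zeta> > 0"
  shows "set_integrable lborel {0<..} (\<lambda>t. exp (- (\<zeta>\<^sup>2 / (4 * t)) - t) * t powr (- 1 - \<nu>))"
proof -
  define n where "n = nat \<lceil>\<nu>\<rceil> + 1"
  define c where "c = \<zeta>\<^sup>2 / 4"
  have c: "c > 0" using assms by (simp add: c_def)
  have n: "real n > \<nu>" unfolding n_def by linarith
  have fin: "(\<integral>\<^sup>+t. ennreal (indicator {0<..} t * (t powr ((real n - \<nu>) - 1) * exp (- t))) \<partial>lborel) < \<infinity>"
    using n by (subst nn_integral_Gamma_real) auto
  have int: "integrable lborel (\<lambda>t. indicator {0<..} t * (t powr ((real n - \<nu>) - 1) * exp (- t)))"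
    by (intro integrableI_nonneg) (use fin in \<open>auto simp: indicator_def\<close>)
  show ?thesis
    unfolding set_integrable_def
  proof (rule Bochner_Integration.integrable_bound[OF integrable_mult_right[OF int, of "fact n / c ^ n"]])
    show "AE t in lborel. norm (indicat_real {0<..} t *\<^sub>R (exp (- (\<zeta>\<^sup>2 / (4 * t)) - t) * t powr (- 1 - \<nu>)))
        \<le> norm (fact n / c ^ n * (indicat_real {0<..} t * (t powr (real n - \<nu> - 1) * exp (- t))))"
    proof (intro AE_I2)
      fix t :: real
      show "norm (indicat_real {0<..} t *\<^sub>R (exp (- (\<zeta>\<^sup>2 / (4 * t)) - t) * t powr (- 1 - \<nu>)))
        \<le> norm (fact n / c ^ n * (indicat_real {0<..} t * (t powr (real n - \<nu> - 1) * exp (- t))))"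
      proof (cases "t > 0")
        case True
        have "(c / t) ^ n / fact n \<le> exp (c / t)"
          using c True by (intro power_div_fact_le_exp) auto
        then have "1 / exp (c / t) \<le> 1 / ((c / t) ^ n / fact n)"
          using c True by (intro divide_left_mono) auto
        then have 1: "exp (- (c / t)) \<le> fact n / c ^ n * t ^ n"
          using c True by (simp add: power_divide exp_minus inverse_eq_divide mult.commute)
        have "t ^ n * t powr (- 1 - \<nu>) = t powr (real n + (- 1 - \<nu>))"
          using True by (simp only: powr_realpow[symmetric] powr_add)
        also have "real n + (- 1 - \<nu>) = real n - \<nu> - 1" by simp
        finally have 2: "t ^ n * t powr (- 1 - \<nu>) = t powr (real n - \<nu> - 1)" .
        have "exp (- (\<zeta>\<^sup>2 / (4 * t)) - t) * t powr (- 1 - \<nu>)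
            = exp (- (c / t)) * (exp (- t) * t powr (- 1 - \<nu>))"
          by (simp only: c_def exp_add[symmetric] mult.assoc[symmetric]) simp
        also have "\<dots> \<le> fact n / c ^ n * t ^ n * (exp (- t) * t powr (- 1 - \<nu>))"
          by (intro mult_right_mono 1) auto
        also have "\<dots> = fact n / c ^ n * (t powr (real n - \<nu> - 1) * exp (- t))"
          unfolding 2[symmetric] by (simp only: mult_ac)
        finally have "norm (exp (- (\<zeta>\<^sup>2 / (4 * t)) - t) * t powr (- 1 - \<nu>))
            \<le> norm (fact n / c ^ n * (t powr (real n - \<nu> - 1) * exp (- t)))"
          using c by (simp add: abs_mult)
        then show ?thesis using True by simp
      qed auto
    qed
    show "(\<lambda>t. indicat_real {0<..} t *\<^sub>R (exp (- (\<zeta>\<^sup>2 / (4 * t)) - t) * t powr (- 1 - \<nu>)))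
        \<in> borel_measurable lborel"
      by measurable
  qed
qed

text \<open>
  The kernel of \<open>(-\<Delta> + m\<^sup>2)\<^sup>s\<close> including its normalising constant. At the origin, division by zero gives it
  the value \<open>0\<close>.
\<close>

definition frac_kernel :: "real \<Rightarrow> real \<Rightarrow> real^3 \<Rightarrow> real" where
  "frac_kernel m s h = C_const s * m powr ((3 + 2 * s) / 2) *
     (bessel_K ((3 + 2 * s) / 2) (m * norm h) / norm h powr ((3 + 2 * s) / 2))"

text \<open>
  Integrating the Gaussian mixture first over \<open>h\<close> turns the \<open>2 k\<close>-th moment into a constant times
  \<open>\<integral> t\<^bsup>k - s - 1\<^esup> exp (- t) dt = \<Gamma>(k - s)\<close>. For \<open>k = 0\<close> this integral would diverge, reflecting the
  singularity of the kernel. The normalisation \<open>C_const\<close> cancels every power of \<open>2\<close> and \<open>\<pi>\<close>.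
\<close>

lemma nn_integral_frac_kernel_moment:
  fixes b :: "real^3"
  assumes s: "0 < s" "s < 1" and m: "m > 0" and b: "b \<in> Basis" and k: "k \<ge> 1"
  shows "(\<integral>\<^sup>+h. ennreal ((h \<bullet> b) ^ (2 * k) * frac_kernel m s h) \<partial>lborel)
    = ennreal (s * (fact (2 * k) / fact k) * m powr (2 * s - 2 * real k) * (Gamma (real k - s) / Gamma (1 - s)))"
proof -
  define \<nu> where "\<nu> = (3 + 2 * s) / 2"
  define D where "D = C_const s * m powr \<nu> * (1 / 2 * (m / 2) powr \<nu>)"
  define g :: real where "g = fact (2 * k) / (2 ^ (2 * k) * fact k)"
  define q where "q = 3 / 2 + real k"
  define E where "E t = indicat_real {0<..} t * (exp (- t) * t powr (- 1 - \<nu>))" for t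
  define W where "W = sqrt pi ^ 3 * g * (4 / m\<^sup>2) powr q"
  have G: "Gamma (1 - s) > 0" "Gamma (real k - s) > 0"
    using s k by (auto intro!: Gamma_real_pos)
  have D: "D \<ge> 0"
    using s m G by (auto simp: D_def C_const_def intro!: mult_nonneg_nonneg divide_nonneg_nonneg)
  have E: "E t \<ge> 0" for t by (simp add: E_def)
  have g: "g \<ge> 0" by (simp add: g_def)
  have W: "W \<ge> 0" using g by (simp add: W_def)
  have [measurable]: "E \<in> borel_measurable borel"
    unfolding E_def by measurable

  \<comment> \<open>Away from the origin the kernel is a mixture of Gaussians of variance proportional to \<open>t\<close>.\<close>
  have mix: "ennreal ((h \<bullet> b) ^ (2 * k) * frac_kernel m s h)
      = (\<integral>\<^sup>+t. ennreal (D * E t) * ennreal ((h \<bullet> b) ^ (2 * k) * exp (- (m\<^sup>2 / (4 * t) * (norm h)\<^sup>2))) \<partial>lborel)"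
    if h: "h \<noteq> 0" for h
  proof -
    let ?f = "\<lambda>t. indicat_real {0<..} t *\<^sub>R (exp (- ((m * norm h)\<^sup>2 / (4 * t)) - t) * t powr (- 1 - \<nu>))"
    have int: "integrable lborel ?f"
      using bessel_K_integrand_integrable[of "m * norm h" \<nu>] m h unfolding set_integrable_def by simp
    have pw: "(m * norm h / 2) powr \<nu> = (m / 2) powr \<nu> * norm h powr \<nu>"
      using m by (subst powr_mult[symmetric]) auto
    have "frac_kernel m s h = D * (LINT t|lborel. ?f t)"
      using h by (simp add: frac_kernel_def bessel_K_def D_def pw \<nu>_def[symmetric] set_lebesgue_integral_def)
    then have "ennreal ((h \<bullet> b) ^ (2 * k) * frac_kernel m s h) = ennreal (LINT t|lborel. (D * (h \<bullet> b) ^ (2 * k)) * ?f t)"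
      by (simp only: integral_mult_right_zero mult_ac)
    also have "\<dots> = (\<integral>\<^sup>+t. ennreal ((D * (h \<bullet> b) ^ (2 * k)) * ?f t) \<partial>lborel)"
    proof (rule nn_integral_eq_integral[symmetric])
      show "integrable lborel (\<lambda>t. (D * (h \<bullet> b) ^ (2 * k)) * ?f t)"
        by (rule integrable_mult_right[OF int])
      show "AE t in lborel. 0 \<le> (D * (h \<bullet> b) ^ (2 * k)) * ?f t"
        using D by (intro AE_I2 mult_nonneg_nonneg) auto
    qed
    also have "\<dots> = (\<integral>\<^sup>+t. ennreal (D * E t) * ennreal ((h \<bullet> b) ^ (2 * k) * exp (- (m\<^sup>2 / (4 * t) * (norm h)\<^sup>2))) \<partial>lborel)"
    proof (intro nn_integral_cong)
      fix t :: real
      have "exp (- ((m * norm h)\<^sup>2 / (4 * t)) - t) = exp (- (m\<^sup>2 / (4 * t) * (norm h)\<^sup>2)) * exp (- t)"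
        by (simp add: exp_add[symmetric] power_mult_distrib)
      then have "D * (h \<bullet> b) ^ (2 * k) * ?f t = (D * E t) * ((h \<bullet> b) ^ (2 * k) * exp (- (m\<^sup>2 / (4 * t) * (norm h)\<^sup>2)))"
        by (simp add: E_def)
      then show "ennreal (D * (h \<bullet> b) ^ (2 * k) * ?f t)
          = ennreal (D * E t) * ennreal ((h \<bullet> b) ^ (2 * k) * exp (- (m\<^sup>2 / (4 * t) * (norm h)\<^sup>2)))"
        using D E[of t] by (simp only: ennreal_mult'[OF mult_nonneg_nonneg[OF D E]])
    qed
    finally show ?thesis .
  qed
  have gauss: "(\<integral>\<^sup>+h. ennreal (D * E t) * ennreal ((h \<bullet> b) ^ (2 * k) * exp (- (m\<^sup>2 / (4 * t) * (norm h)\<^sup>2))) \<partial>lborel)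
      = ennreal (D * W) * ennreal (indicator {0<..} t * (t powr ((real k - s) - 1) * exp (- t)))" for t
  proof (cases "t > 0")
    case True
    have "(m\<^sup>2 / (4 * t)) powr (- real DIM(real^3) / 2 - real k) = ((4 / m\<^sup>2) * t) powr q"
    proof -
      have "(m\<^sup>2 / (4 * t)) = inverse ((4 / m\<^sup>2) * t)"
        by (simp add: field_simps)
      moreover have "- real DIM(real^3) / 2 - real k = - q"
        by (simp add: q_def)
      ultimately show ?thesis
        by (simp only: inverse_powr powr_minus inverse_inverse_eq)
    qed
    also have "\<dots> = (4 / m\<^sup>2) powr q * t powr q"
      using m True by (intro powr_mult)
    finally have e: "(m\<^sup>2 / (4 * t)) powr (- real DIM(real^3) / 2 - real k) = (4 / m\<^sup>2) powr q * t powr q" .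
    have "(\<integral>\<^sup>+h. ennreal (D * E t) * ennreal ((h \<bullet> b) ^ (2 * k) * exp (- (m\<^sup>2 / (4 * t) * (norm h)\<^sup>2))) \<partial>lborel)
       = ennreal (D * E t) * (\<integral>\<^sup>+h. ennreal ((h \<bullet> b) ^ (2 * k) * exp (- (m\<^sup>2 / (4 * t) * (norm h)\<^sup>2))) \<partial>lborel)"
      by (intro nn_integral_cmult) measurable
    also have "\<dots> = ennreal (D * E t) * ennreal (sqrt pi ^ DIM(real^3) * g * ((4 / m\<^sup>2) powr q * t powr q))"
      using True m by (subst nn_integral_even_moment_gaussian[OF _ b]) (auto simp: e[symmetric] g_def)
    also have "sqrt pi ^ DIM(real^3) * g * ((4 / m\<^sup>2) powr q * t powr q) = W * t powr q"
      by (simp add: W_def)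
    also have "ennreal (D * E t) * ennreal (W * t powr q) = ennreal ((D * W) * (E t * t powr q))"
      using D W E by (subst ennreal_mult'[symmetric]) (auto simp: mult_ac)
    also have "E t * t powr q = indicator {0<..} t * (t powr ((real k - s) - 1) * exp (- t))"
    proof -
      have "t powr (- 1 - \<nu>) * t powr q = t powr ((real k - s) - 1)"
      proof -
        have "- 1 - \<nu> + q = (real k - s) - 1" by (simp add: \<nu>_def q_def add_divide_distrib)
        then show ?thesis by (simp only: powr_add[symmetric])
      qed
      then show ?thesis by (simp add: E_def)
    qed
    also have "ennreal ((D * W) * (indicator {0<..} t * (t powr ((real k - s) - 1) * exp (- t))))
       = ennreal (D * W) * ennreal (indicator {0<..} t * (t powr ((real k - s) - 1) * exp (- t)))"
      using D W by (intro ennreal_mult') auto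
    finally show ?thesis .
  qed (simp add: E_def)
  \<comment> \<open>Collecting the powers of \<open>\<pi>\<close>, \<open>m\<close> and \<open>2\<close> separately.\<close>
  have const: "D * W * Gamma (real k - s)
      = s * (fact (2 * k) / fact k) * m powr (2 * s - 2 * real k) * (Gamma (real k - s) / Gamma (1 - s))"
  proof -
    have p: "sqrt pi ^ 3 = pi powr (3 / 2)"
      by (simp add: powr_half_sqrt[symmetric] powr_power)
    have q4: "(4 / m\<^sup>2) powr q = 2 powr (2 * q) * m powr (- 2 * q)"
    proof -
      have "(4 / m\<^sup>2) powr q = ((2 / m) powr 2) powr q" using m by (simp add: power_divide)
      also have "\<dots> = 2 powr (2 * q) / m powr (2 * q)" by (simp only: powr_powr powr_divide)
      also have "\<dots> = 2 powr (2 * q) * m powr (- 2 * q)" by (simp only: mult_minus_left powr_minus divide_inverse)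
      finally show ?thesis .
    qed
    have m2: "(m / 2) powr \<nu> = m powr \<nu> * 2 powr (- \<nu>)"
      unfolding powr_divide by (simp only: powr_minus divide_inverse)
    have "m powr \<nu> * m powr \<nu> * m powr (- 2 * q) = m powr (\<nu> + \<nu> + - 2 * q)"
      by (simp only: powr_add)
    also have "\<nu> + \<nu> + - 2 * q = 2 * s - 2 * real k" by (simp add: \<nu>_def q_def)
    finally have mm: "m powr \<nu> * m powr \<nu> * m powr (- 2 * q) = m powr (2 * s - 2 * real k)" .
    have "2 powr ((2 * s - 1) / 2) * (1 / 2) * 2 powr (- \<nu>) * 2 powr (2 * q)
        = 2 powr ((2 * s - 1) / 2) * 2 powr (- 1) * 2 powr (- \<nu>) * 2 powr (2 * q)"
      by (simp add: powr_minus)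
    also have "\<dots> = 2 powr ((2 * s - 1) / 2 + - 1 + - \<nu> + 2 * q)"
      by (simp only: powr_add)
    also have "(2 * s - 1) / 2 + - 1 + - \<nu> + 2 * q = real (2 * k)" by (simp add: \<nu>_def q_def field_simps)
    also have "2 powr real (2 * k) = (2::real) ^ (2 * k)" by (rule powr_realpow) simp
    finally have tt: "2 powr ((2 * s - 1) / 2) * (1 / 2) * 2 powr (- \<nu>) * 2 powr (2 * q) = (2::real) ^ (2 * k)" .
    have "D * W * Gamma (real k - s) = s * (g * (2 powr ((2 * s - 1) / 2) * (1 / 2) * 2 powr (- \<nu>) * 2 powr (2 * q)))
        * (m powr \<nu> * m powr \<nu> * m powr (- 2 * q)) * (Gamma (real k - s) / Gamma (1 - s))"
      unfolding D_def W_def C_const_def p q4 m2 by (simp add: mult_ac)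
    also have "g * (2 powr ((2 * s - 1) / 2) * (1 / 2) * 2 powr (- \<nu>) * 2 powr (2 * q)) = fact (2 * k) / fact k"
      unfolding tt g_def by simp
    finally show ?thesis unfolding mm by simp
  qed
  have "(\<integral>\<^sup>+h. ennreal ((h \<bullet> b) ^ (2 * k) * frac_kernel m s h) \<partial>lborel)
      = (\<integral>\<^sup>+h. (\<integral>\<^sup>+t. ennreal (D * E t) * ennreal ((h \<bullet> b) ^ (2 * k) * exp (- (m\<^sup>2 / (4 * t) * (norm h)\<^sup>2))) \<partial>lborel) \<partial>lborel)"
  proof (rule nn_integral_cong_AE)
    show "AE h in lborel. ennreal ((h \<bullet> b) ^ (2 * k) * frac_kernel m s h)
        = (\<integral>\<^sup>+t. ennreal (D * E t) * ennreal ((h \<bullet> b) ^ (2 * k) * exp (- (m\<^sup>2 / (4 * t) * (norm h)\<^sup>2))) \<partial>lborel)"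
      using AE_lborel_singleton[of "0::real^3"] by eventually_elim (rule mix)
  qed
  also have "\<dots> = (\<integral>\<^sup>+t. (\<integral>\<^sup>+h. ennreal (D * E t) * ennreal ((h \<bullet> b) ^ (2 * k) * exp (- (m\<^sup>2 / (4 * t) * (norm h)\<^sup>2))) \<partial>lborel) \<partial>lborel)"
    by (intro lborel_pair.Fubini') measurable
  also have "\<dots> = ennreal (D * W) * ennreal (Gamma (real k - s))"
    unfolding gauss using s k
    by (subst nn_integral_cmult) (auto simp: nn_integral_Gamma_real)
  also have "\<dots> = ennreal (D * W * Gamma (real k - s))"
    using D W by (intro ennreal_mult'[symmetric]) auto
  finally show ?thesis unfolding const .
qed

lemma measurable_frac_kernel [measurable]: "frac_kernel m s \<in> borel_measurable borel"
  unfolding frac_kernel_def[abs_def] by measurable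

lemma frac_kernel_nonneg:
  assumes "0 < s" "s < 1"
  shows "frac_kernel m s h \<ge> 0"
  using assms bessel_K_nonneg Gamma_real_pos[of "1 - s"]
  by (auto simp: frac_kernel_def C_const_def intro!: mult_nonneg_nonneg divide_nonneg_nonneg)

lemma has_bochner_integral_frac_kernel_moment:
  fixes b :: "real^3"
  assumes s: "0 < s" "s < 1" and m: "m > 0" and b: "b \<in> Basis" and k: "k \<ge> 1"
  shows "has_bochner_integral lborel (\<lambda>h. (h \<bullet> b) ^ (2 * k) * frac_kernel m s h)
    (s * (fact (2 * k) / fact k) * m powr (2 * s - 2 * real k) * (Gamma (real k - s) / Gamma (1 - s)))"
proof (rule has_bochner_integral_nn_integral)
  show "0 \<le> s * (fact (2 * k) / fact k) * m powr (2 * s - 2 * real k) * (Gamma (real k - s) / Gamma (1 - s))"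
    using s k Gamma_real_pos[of "1 - s"] Gamma_real_pos[of "real k - s"]
    by (auto intro!: mult_nonneg_nonneg divide_nonneg_nonneg)
  show "AE h in lborel. 0 \<le> (h \<bullet> b) ^ (2 * k) * frac_kernel m s h"
    by (intro AE_I2 mult_nonneg_nonneg frac_kernel_nonneg s) simp
qed (use nn_integral_frac_kernel_moment[OF assms] in simp_all)

lemma has_bochner_integral_frac_kernel_second_moment:
  fixes b :: "real^3"
  assumes s: "0 < s" "s < 1" and m: "m > 0" and b: "b \<in> Basis"
  shows "has_bochner_integral lborel (\<lambda>h. (h \<bullet> b)\<^sup>2 * frac_kernel m s h) (2 * s * m powr (2 * s - 2))"
proof -
  have "Gamma (1 - s) > 0" using s by (intro Gamma_real_pos) simp
  then show ?thesis
    using has_bochner_integral_frac_kernel_moment[OF assms, of 1] by (simp add: fact_numeral mult.commute)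
qed

text \<open>
  The vanishing factor \<open>1 - s\<close> is the quotient \<open>\<Gamma>(2 - s) / \<Gamma>(1 - s)\<close>.
\<close>

lemma has_bochner_integral_frac_kernel_fourth_moment:
  fixes b :: "real^3"
  assumes s: "0 < s" "s < 1" and m: "m > 0" and b: "b \<in> Basis"
  shows "has_bochner_integral lborel (\<lambda>h. (h \<bullet> b) ^ 4 * frac_kernel m s h) (12 * s * (1 - s) * m powr (2 * s - 4))"
proof -
  have G: "Gamma (1 - s) > 0" using s by (intro Gamma_real_pos) simp
  have "Gamma ((1 - s) + 1) = (1 - s) * Gamma (1 - s)"
    using s by (intro Gamma_plus1) (auto elim!: nonpos_Ints_cases')
  then have r: "Gamma (2 - s) / Gamma (1 - s) = 1 - s" using G by simp
  have "s * (fact (2 * 2) / fact 2) * m powr (2 * s - 2 * real 2) * (Gamma (real 2 - s) / Gamma (1 - s))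
      = 12 * s * (1 - s) * m powr (2 * s - 4)"
    unfolding of_nat_numeral r by (simp add: fact_numeral algebra_simps)
  then show ?thesis
    using has_bochner_integral_frac_kernel_moment[OF assms, of 2] by simp
qed

lemma radial_kernel_frac_kernel:
  assumes s: "0 < s" "s < 1" and m: "m > 0"
  shows "radial_kernel (frac_kernel m s)"
proof
  show "frac_kernel m s \<in> borel_measurable borel" by measurable
  show "frac_kernel m s h \<ge> 0" for h by (rule frac_kernel_nonneg[OF s])
  show "norm h = norm h' \<Longrightarrow> frac_kernel m s h = frac_kernel m s h'" for h h'
    by (simp add: frac_kernel_def)
  have sq: "(norm h)\<^sup>2 = (\<Sum>b\<in>Basis. (h \<bullet> b)\<^sup>2)" for h :: "real^3"
    by (rule power2_norm_eq_sum_inner)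
  show "integrable lborel (\<lambda>h. (norm h)\<^sup>2 * frac_kernel m s h)"
    unfolding sq sum_distrib_right
    by (intro Bochner_Integration.integrable_sum integrable.intros[OF has_bochner_integral_frac_kernel_second_moment] assms)
qed

lemma tendsto_integral_frac_kernel:
  fixes \<psi> :: "real^3 \<Rightarrow> complex"
  assumes m: "m > 0"
    and \<psi>: "\<psi> \<in> borel_measurable borel" "\<psi> 0 = 0" "\<And>h. norm (\<psi> h) \<le> B"
    and o: "(\<lambda>h. \<psi> h + quad_form c h) \<in> o[at 0](\<lambda>h. of_real (norm h) ^ 2)"
  shows "((\<lambda>s. LINT h|lborel. \<psi> h * of_real (frac_kernel m s h)) \<longlongrightarrow> - (2 * (\<Sum>b\<in>Basis. c b b))) (at_left 1)"
proof -
  have ev: "\<forall>\<^sub>F s in at_left 1. s \<in> {0<..<1::real}"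
    by (rule eventually_at_left_real) simp
  have m0: "m \<noteq> 0" using m by simp
  have "((\<lambda>s. LINT h|lborel. \<psi> h * of_real (frac_kernel m s h))
      \<longlongrightarrow> - (of_real 2 * (\<Sum>b\<in>Basis. c b b))) (at_left 1)"
  proof (rule tendsto_integral_concentrating_kernels[OF _ _ _ _ \<psi> o])
    show "\<forall>\<^sub>F s in at_left 1. radial_kernel (frac_kernel m s)"
      using ev by eventually_elim (auto intro: radial_kernel_frac_kernel m)
    fix b :: "real^3" assume b: "b \<in> Basis"
    have "\<forall>\<^sub>F s in at_left 1. 2 * s * m powr (2 * s - 2) = (LINT h|lborel. (h \<bullet> b)\<^sup>2 * frac_kernel m s h)"
      using ev
      by eventually_elim
        (auto intro!: has_bochner_integral_integral_eq[symmetric] has_bochner_integral_frac_kernel_second_moment m b)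
    moreover have "((\<lambda>s. 2 * s * m powr (2 * s - 2)) \<longlongrightarrow> 2 * 1 * m powr (2 * 1 - 2)) (at_left 1)"
      using m0 by (intro tendsto_intros) auto
    ultimately show "((\<lambda>s. LINT h|lborel. (h \<bullet> b)\<^sup>2 * frac_kernel m s h) \<longlongrightarrow> 2) (at_left 1)"
      using m by (simp add: tendsto_cong)
    show "\<forall>\<^sub>F s in at_left 1. integrable lborel (\<lambda>h. (h \<bullet> b) ^ 4 * frac_kernel m s h)"
      using ev
      by eventually_elim (auto intro!: integrable.intros[OF has_bochner_integral_frac_kernel_fourth_moment] m b)
    have "\<forall>\<^sub>F s in at_left 1. 12 * s * (1 - s) * m powr (2 * s - 4) = (LINT h|lborel. (h \<bullet> b) ^ 4 * frac_kernel m s h)"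
      using ev
      by eventually_elim
        (auto intro!: has_bochner_integral_integral_eq[symmetric] has_bochner_integral_frac_kernel_fourth_moment m b)
    moreover have "((\<lambda>s. 12 * s * (1 - s) * m powr (2 * s - 4)) \<longlongrightarrow> 12 * 1 * (1 - 1) * m powr (2 * 1 - 4)) (at_left 1)"
      using m0 by (intro tendsto_intros) auto
    ultimately show "((\<lambda>s. LINT h|lborel. (h \<bullet> b) ^ 4 * frac_kernel m s h) \<longlongrightarrow> 0) (at_left 1)"
      by (simp add: tendsto_cong)
  qed
  then show ?thesis by simp
qed

section \<open>Second-order expansion of the gauge-translated function\<close>

text \<open>
  Peano's form of Taylor's theorem, which asks only for differentiability of the first derivatives at
  the point \<open>x\<close>. Along the segment \<open>t \<mapsto> x + t h\<close> the derivative of the remainder is a first-order remainder of the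
  functions \<open>d b\<close>, multiplied by the components of \<open>h\<close>; it is \<open>o(|h|\<^sup>2)\<close>, and the mean value inequality transfers this
  to the remainder itself.
\<close>

lemma second_order_taylor:
  fixes u :: "'a::euclidean_space \<Rightarrow> complex" and d :: "'a \<Rightarrow> 'a \<Rightarrow> complex"
  assumes du: "\<And>y. (u has_derivative (\<lambda>v. \<Sum>b\<in>Basis. of_real (v \<bullet> b) * d b y)) (at y)"
    and dd: "\<And>b. b \<in> Basis \<Longrightarrow> (d b has_derivative dd b) (at x)"
  shows "(\<lambda>h. u (x + h) - (u x + (\<Sum>b\<in>Basis. of_real (h \<bullet> b) * d b x) + quad_form (\<lambda>a b. dd b a / 2) h))
    \<in> o[at 0](\<lambda>h. of_real (norm h) ^ 2)"
proof (rule landau_o.smallI)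
  fix e :: real assume e: "e > 0"
  define \<eta> where "\<eta> = e / DIM('a)"
  have \<eta>: "\<eta> > 0" using e by (simp add: \<eta>_def)
  have "\<forall>\<^sub>F k in nhds 0. \<forall>b\<in>Basis. norm (d b (x + k) - d b x - dd b k) \<le> \<eta> * norm k"
  proof (intro eventually_ball_finite ballI)
    fix b :: 'a assume "b \<in> Basis"
    then obtain r where "r > 0" "\<And>y. norm (y - x) < r \<Longrightarrow> norm (d b y - d b x - dd b (y - x)) \<le> \<eta> * norm (y - x)"
      using dd[of b] \<eta> unfolding has_derivative_at_alt by meson
    from this(1) this(2)[of "x + k" for k] show "\<forall>\<^sub>F k in nhds 0. norm (d b (x + k) - d b x - dd b k) \<le> \<eta> * norm k"
      unfolding eventually_nhds_metric by auto
  qed simp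
  then obtain r where r: "r > 0"
    "\<And>k b. norm k < r \<Longrightarrow> b \<in> Basis \<Longrightarrow> norm (d b (x + k) - d b x - dd b k) \<le> \<eta> * norm k"
    unfolding eventually_nhds_metric by auto
  have main: "norm (u (x + h) - (u x + (\<Sum>b\<in>Basis. of_real (h \<bullet> b) * d b x) + quad_form (\<lambda>a b. dd b a / 2) h))
      \<le> e * (norm h)\<^sup>2" if h: "norm h < r" for h
  proof -
    have lin: "dd b (t *\<^sub>R h) = of_real t * (\<Sum>a\<in>Basis. of_real (h \<bullet> a) * dd b a)" if "b \<in> Basis" for b t
    proof -
      have "linear (dd b)" using dd[OF that] by (rule has_derivative_linear)
      then have "dd b (t *\<^sub>R (\<Sum>a\<in>Basis. (h \<bullet> a) *\<^sub>R a)) = of_real t * (\<Sum>a\<in>Basis. of_real (h \<bullet> a) * dd b a)"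
        by (simp add: linear_cmul linear_sum scaleR_conv_of_real mult.assoc)
      then show ?thesis by (simp only: euclidean_representation)
    qed
    have q: "quad_form (\<lambda>a b. dd b a / 2) h = (\<Sum>b\<in>Basis. of_real (h \<bullet> b) * (\<Sum>a\<in>Basis. of_real (h \<bullet> a) * dd b a)) / 2"
      unfolding quad_form_def by (subst sum.swap) (simp add: sum_distrib_left sum_divide_distrib mult_ac)
    \<comment> \<open>The increment of \<open>G\<close> over \<open>{0..1}\<close> is the Taylor remainder.\<close>
    define G where "G t = u (x + t *\<^sub>R h) - (of_real t * (\<Sum>b\<in>Basis. of_real (h \<bullet> b) * d b x)
        + of_real (t\<^sup>2) * quad_form (\<lambda>a b. dd b a / 2) h)" for t :: real
    define G' where "G' t = (\<Sum>b\<in>Basis. of_real (h \<bullet> b) * (d b (x + t *\<^sub>R h) - d b x - dd b (t *\<^sub>R h)))" for t :: real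
    have G: "(G has_vector_derivative G' t) (at t)" for t
    proof -
      have "((\<lambda>t. u (x + t *\<^sub>R h)) has_derivative (\<lambda>s. \<Sum>b\<in>Basis. of_real ((s *\<^sub>R h) \<bullet> b) * d b (x + t *\<^sub>R h))) (at t)"
        by (rule has_derivative_compose[OF _ du]) (auto intro!: derivative_eq_intros)
      then have 1: "((\<lambda>t. u (x + t *\<^sub>R h)) has_vector_derivative (\<Sum>b\<in>Basis. of_real (h \<bullet> b) * d b (x + t *\<^sub>R h))) (at t)"
        unfolding has_vector_derivative_def by (simp add: sum_distrib_left scaleR_conv_of_real mult.assoc)
      have 2: "((\<lambda>t. of_real t * (\<Sum>b\<in>Basis. of_real (h \<bullet> b) * d b x)
        + of_real (t\<^sup>2) * quad_form (\<lambda>a b. dd b a / 2) h) has_vector_derivative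
          (\<Sum>b\<in>Basis. of_real (h \<bullet> b) * d b x) + of_real (2 * t) * quad_form (\<lambda>a b. dd b a / 2) h) (at t)"
        by (auto intro!: derivative_eq_intros simp: has_vector_derivative_def scaleR_conv_of_real algebra_simps fun_eq_iff)
      have eq: "(\<Sum>b\<in>Basis. of_real (h \<bullet> b) * d b (x + t *\<^sub>R h)) - ((\<Sum>b\<in>Basis. of_real (h \<bullet> b) * d b x)
          + of_real (2 * t) * quad_form (\<lambda>a b. dd b a / 2) h) = G' t"
      proof -
        have "of_real (2 * t) * quad_form (\<lambda>a b. dd b a / 2) h = (\<Sum>b\<in>Basis. of_real (h \<bullet> b) * dd b (t *\<^sub>R h))"
          unfolding q by (simp add: lin sum_distrib_left mult_ac)
        then show ?thesis
          unfolding G'_def by (simp only: right_diff_distrib distrib_left sum.distrib sum_subtractf diff_diff_eq)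
      qed
      show ?thesis
        unfolding G_def using has_vector_derivative_diff[OF 1 2] unfolding eq .
    qed
    have bnd: "norm (G' t) \<le> e * (norm h)\<^sup>2" if t: "0 < t" "t < 1" for t
    proof -
      have th: "norm (t *\<^sub>R h) \<le> norm h" "norm (t *\<^sub>R h) < r"
        using t h mult_left_le_one_le[of "norm h" t] by auto
      have "norm (G' t) \<le> (\<Sum>b\<in>(Basis :: 'a set). norm h * (\<eta> * norm h))"
        unfolding G'_def
      proof (intro sum_norm_le)
        fix b :: 'a assume b: "b \<in> Basis"
        have "norm (d b (x + t *\<^sub>R h) - d b x - dd b (t *\<^sub>R h)) \<le> \<eta> * norm (t *\<^sub>R h)"
          by (rule r(2)[OF th(2) b])
        also have "\<dots> \<le> \<eta> * norm h" using \<eta> th(1) by (intro mult_left_mono) auto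
        finally have "norm (of_real (h \<bullet> b) :: complex) * norm (d b (x + t *\<^sub>R h) - d b x - dd b (t *\<^sub>R h)) \<le> norm h * (\<eta> * norm h)"
          using b by (intro mult_mono) (auto simp: Basis_le_norm)
        then show "norm (of_real (h \<bullet> b) * (d b (x + t *\<^sub>R h) - d b x - dd b (t *\<^sub>R h))) \<le> norm h * (\<eta> * norm h)"
          by (simp only: norm_mult)
      qed
      also have "\<dots> = e * (norm h)\<^sup>2" by (simp add: \<eta>_def power2_eq_square)
      finally show ?thesis .
    qed
    have "norm (G 1 - G 0) \<le> e * (norm h)\<^sup>2 * 1 - e * (norm h)\<^sup>2 * 0"
    proof (rule differentiable_bound_general[where \<phi> = "\<lambda>t. e * (norm h)\<^sup>2 * t" and f' = G' and \<phi>' = "\<lambda>_. e * (norm h)\<^sup>2"])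
      show "continuous_on {0..1} G"
        using G by (intro continuous_at_imp_continuous_on ballI has_vector_derivative_continuous)
      show "((\<lambda>t. e * (norm h)\<^sup>2 * t) has_vector_derivative e * (norm h)\<^sup>2) (at t)" for t
        by (auto intro!: derivative_eq_intros simp: has_vector_derivative_def)
    qed (auto intro!: G bnd continuous_intros)
    moreover have "G 1 - G 0 = u (x + h) - (u x + (\<Sum>b\<in>Basis. of_real (h \<bullet> b) * d b x) + quad_form (\<lambda>a b. dd b a / 2) h)"
      by (simp add: G_def)
    ultimately show ?thesis by simp
  qed
  have "\<forall>\<^sub>F h in at 0. norm h < r"
    using r(1) by (auto simp: eventually_at intro!: exI[of _ r])
  then show "\<forall>\<^sub>F h in at 0. norm (u (x + h) - (u x + (\<Sum>b\<in>Basis. of_real (h \<bullet> b) * d b x) + quad_form (\<lambda>a b. dd b a / 2) h))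
      \<le> e * norm (of_real (norm h) ^ 2 :: complex)"
    by eventually_elim (use main in \<open>simp add: norm_power\<close>)
qed

lemma bigo_cube_imp_smallo_square:
  fixes f :: "'a::real_normed_vector \<Rightarrow> complex"
  assumes "f \<in> O[at 0](\<lambda>h. of_real (norm h) ^ 3)"
  shows "f \<in> o[at 0](\<lambda>h. of_real (norm h) ^ 2)"
proof -
  have "((\<lambda>h::'a. norm h) \<longlongrightarrow> norm (0::'a)) (at 0)"
    by (rule tendsto_norm[OF tendsto_ident_at])
  then have "((\<lambda>h::'a. complex_of_real (norm h)) \<longlongrightarrow> of_real 0) (at 0)"
    by (intro tendsto_of_real) simp
  then have "(\<lambda>h::'a. complex_of_real (norm h)) \<in> o[at 0](\<lambda>_. 1)"
    by (intro smalloI_tendsto) auto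
  then have "(\<lambda>h::'a. of_real (norm h) * of_real (norm h) ^ 2) \<in> o[at 0](\<lambda>h. 1 * complex_of_real (norm h) ^ 2)"
    by (intro landau_o.small_big_mult landau_o.big_refl)
  then have "(\<lambda>h::'a. of_real (norm h) ^ 3) \<in> o[at 0](\<lambda>h. complex_of_real (norm h) ^ 2)"
    by (simp add: power3_eq_cube power2_eq_square mult_ac)
  with assms show ?thesis by (rule landau_o.big_small_trans)
qed

lemma bigo_square_imp_bigo:
  fixes f :: "'a::real_normed_vector \<Rightarrow> complex"
  assumes "f \<in> O[at 0](\<lambda>h. of_real (norm h) ^ 2)"
  shows "f \<in> O[at 0](\<lambda>h. of_real (norm h))"
proof -
  have "(\<lambda>h::'a. complex_of_real (norm h) ^ 2) \<in> O[at 0](\<lambda>h. of_real (norm h))"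
  proof (rule bigoI[of _ 1])
    have "\<forall>\<^sub>F h::'a in at 0. norm h < 1"
      by (auto simp: eventually_at intro!: exI[of _ 1])
    then show "\<forall>\<^sub>F h::'a in at 0. norm (complex_of_real (norm h) ^ 2) \<le> 1 * norm (complex_of_real (norm h))"
      by eventually_elim (simp add: power2_eq_square norm_mult mult_left_le)
  qed
  with assms show ?thesis by (rule landau_o.big_trans)
qed

text \<open>
  Passing to the even part removes the linear term \<open>L\<close> and keeps the quadratic term \<open>q\<close>.
\<close>

lemma symmetrised_expansion:
  fixes f L :: "'a::real_normed_vector \<Rightarrow> complex" and g :: "'a \<Rightarrow> complex"
  assumes f: "(\<lambda>h. f h - (f 0 + L h + q h)) \<in> o[at 0](\<lambda>h. of_real (norm h) ^ 2)"
    and odd: "\<And>h. L (- h) = - L h" and even: "\<And>h. q (- h) = q h"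
  shows "(\<lambda>h. (f 0 - (f h + f (- h)) / 2) + q h) \<in> o[at 0](\<lambda>h. of_real (norm h) ^ 2)"
proof -
  have "filterlim uminus (at 0) (at (0::'a))"
    by (auto simp: filterlim_at eventually_at_filter intro!: tendsto_eq_intros)
  from landau_o.small.compose[OF f this]
  have f': "(\<lambda>h. f (- h) - (f 0 - L h + q h)) \<in> o[at 0](\<lambda>h. of_real (norm h) ^ 2)"
    by (simp add: odd even)
  have "(\<lambda>h. - 1 / 2 * ((f h - (f 0 + L h + q h)) + (f (- h) - (f 0 - L h + q h)))) \<in> o[at 0](\<lambda>h. of_real (norm h) ^ 2)"
    using sum_in_smallo(1)[OF f f'] by (subst landau_o.small.cmult_in_iff[of "- 1 / 2"]) simp_all
  also have "(\<lambda>h. - 1 / 2 * ((f h - (f 0 + L h + q h)) + (f (- h) - (f 0 - L h + q h))))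
      = (\<lambda>h. (f 0 - (f h + f (- h)) / 2) + q h)"
    by (auto simp: fun_eq_iff field_simps)
  finally show ?thesis .
qed

text \<open>
  Because the phase contains the factor \<open>h\<close>, a first-order expansion of \<open>A\<close> at \<open>x\<close> determines \<open>\<theta>\<close> up to \<open>o(|h|\<^sup>2)\<close>:
  \<open>\<theta> = \<alpha> + \<beta> + o(|h|\<^sup>2)\<close>, the midpoint contributing the factor \<open>1 / 2\<close> in \<open>\<beta>\<close>. The exponential is then expanded to
  second order, where \<open>\<theta>\<^sup>2\<close> may be replaced by \<open>\<alpha>\<^sup>2\<close> because \<open>\<theta>\<^sup>2 - \<alpha>\<^sup>2 = (\<theta> - \<alpha>) (\<theta> + \<alpha>)\<close> is of third order.
\<close>

lemma gauge_phase_expansion: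
  fixes A A' :: "'a::euclidean_space \<Rightarrow> 'a"
  assumes A: "(A has_derivative A') (at x)"
  defines "\<theta> \<equiv> \<lambda>h. h \<bullet> A (x + h /\<^sub>R 2)"
  defines "\<alpha> \<equiv> \<lambda>h. complex_of_real (h \<bullet> A x)" and "\<beta> \<equiv> \<lambda>h. complex_of_real (h \<bullet> A' h) / 2"
  shows "\<alpha> \<in> O[at 0](\<lambda>h. of_real (norm h))" "\<beta> \<in> O[at 0](\<lambda>h. of_real (norm h) ^ 2)"
    and "(\<lambda>h. exp (- \<i> * of_real (\<theta> h)) - (1 - \<i> * \<alpha> h - \<i> * \<beta> h - (\<alpha> h)\<^sup>2 / 2)) \<in> o[at 0](\<lambda>h. of_real (norm h) ^ 2)"
proof -
  have bl: "bounded_linear A'" using A by (rule has_derivative_bounded_linear)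
  show \<alpha>: "\<alpha> \<in> O[at 0](\<lambda>h. of_real (norm h))"
  proof (rule bigoI[of _ "norm (A x)"], intro always_eventually allI)
    show "norm (\<alpha> h) \<le> norm (A x) * norm (complex_of_real (norm h))" for h
      using Cauchy_Schwarz_ineq2[of h "A x"] by (simp add: \<alpha>_def mult.commute)
  qed
  show \<beta>: "\<beta> \<in> O[at 0](\<lambda>h. of_real (norm h) ^ 2)"
  proof (rule bigoI[of _ "onorm A'"], intro always_eventually allI)
    fix h
    have "norm (\<beta> h) = \<bar>h \<bullet> A' h\<bar> / 2" unfolding \<beta>_def norm_divide norm_of_real by simp
    also have "\<dots> \<le> \<bar>h \<bullet> A' h\<bar>" by simp
    also have "\<dots> \<le> norm h * norm (A' h)" by (rule Cauchy_Schwarz_ineq2)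
    also have "\<dots> \<le> norm h * (onorm A' * norm h)"
      by (intro mult_left_mono onorm bl) auto
    also have "\<dots> = onorm A' * norm (complex_of_real (norm h) ^ 2)"
      by (simp add: power2_eq_square norm_mult)
    finally show "norm (\<beta> h) \<le> onorm A' * norm (complex_of_real (norm h) ^ 2)" .
  qed
  have r: "(\<lambda>h. of_real (\<theta> h) - \<alpha> h - \<beta> h) \<in> o[at 0](\<lambda>h. of_real (norm h) ^ 2)"
  proof (rule landau_o.smallI)
    fix e :: real assume e: "e > 0"
    obtain r where r: "r > 0" "\<And>y. norm (y - x) < r \<Longrightarrow> norm (A y - A x - A' (y - x)) \<le> e * norm (y - x)"
      using A e unfolding has_derivative_at_alt by meson
    have "norm (of_real (\<theta> h) - \<alpha> h - \<beta> h) \<le> e * norm (complex_of_real (norm h) ^ 2)" if h: "norm h < r" for h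
    proof -
      have half: "A' (h /\<^sub>R 2) = A' h /\<^sub>R 2"
        using bl by (simp add: bounded_linear.linear linear_cmul)
      have "of_real (\<theta> h) - \<alpha> h - \<beta> h = complex_of_real (h \<bullet> (A (x + h /\<^sub>R 2) - A x - A' (h /\<^sub>R 2)))"
        unfolding \<theta>_def \<alpha>_def \<beta>_def half by (simp add: inner_diff_right)
      then have "norm (of_real (\<theta> h) - \<alpha> h - \<beta> h) = \<bar>h \<bullet> (A (x + h /\<^sub>R 2) - A x - A' (h /\<^sub>R 2))\<bar>"
        by (simp only: norm_of_real)
      also have "\<dots> \<le> norm h * norm (A (x + h /\<^sub>R 2) - A x - A' (h /\<^sub>R 2))"
        by (rule Cauchy_Schwarz_ineq2)
      also have "\<dots> \<le> norm h * (e * norm (h /\<^sub>R 2))"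
        using r(2)[of "x + h /\<^sub>R 2"] h r(1) by (intro mult_left_mono) auto
      also have "\<dots> \<le> norm h * (e * norm h)"
        using e by (intro mult_left_mono) auto
      also have "\<dots> = e * norm (complex_of_real (norm h) ^ 2)"
        by (simp add: power2_eq_square norm_mult)
      finally show ?thesis .
    qed
    moreover have "\<forall>\<^sub>F h in at 0. norm h < r"
      using r(1) by (auto simp: eventually_at intro!: exI[of _ r])
    ultimately show "\<forall>\<^sub>F h in at 0. norm (of_real (\<theta> h) - \<alpha> h - \<beta> h) \<le> e * norm (complex_of_real (norm h) ^ 2)"
      by (auto elim: eventually_mono)
  qed
  have diff: "(\<lambda>h. of_real (\<theta> h) - \<alpha> h) \<in> O[at 0](\<lambda>h. of_real (norm h) ^ 2)"
    using sum_in_bigo(1)[OF landau_o.small_imp_big[OF r] \<beta>] by simp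
  have \<theta>: "(\<lambda>h. of_real (\<theta> h)) \<in> O[at 0](\<lambda>h. complex_of_real (norm h))"
    using sum_in_bigo(1)[OF bigo_square_imp_bigo[OF diff] \<alpha>] by simp
  have sq: "(\<lambda>h. (of_real (\<theta> h) - \<alpha> h) * (of_real (\<theta> h) + \<alpha> h)) \<in> o[at 0](\<lambda>h. of_real (norm h) ^ 2)"
    using landau_o.big_mult[OF diff sum_in_bigo(1)[OF \<theta> \<alpha>]]
    by (intro bigo_cube_imp_smallo_square) (simp add: power2_eq_square power3_eq_cube)
  define T where "T h = exp (- \<i> * of_real (\<theta> h)) - (1 - \<i> * of_real (\<theta> h) - (of_real (\<theta> h))\<^sup>2 / 2)" for h
  have "T \<in> O[at 0](\<lambda>h. complex_of_real (\<theta> h) ^ 3)"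
  proof (rule bigoI[of _ 1], intro always_eventually allI)
    fix h
    have sum3: "(\<Sum>k\<le>2. f k) = f 0 + f 1 + f 2" for f :: "nat \<Rightarrow> complex"
      by (simp add: numeral_2_eq_2)
    have "T h = exp (- \<i> * of_real (\<theta> h)) - (\<Sum>k\<le>2. (- \<i> * of_real (\<theta> h)) ^ k / fact k)"
      unfolding sum3 by (simp add: T_def power_mult_distrib)
    then have "norm (T h) \<le> exp \<bar>Re (- \<i> * of_real (\<theta> h))\<bar> * norm (- \<i> * of_real (\<theta> h)) ^ Suc 2 / fact 2"
      by (simp only: Taylor_exp)
    also have "\<dots> \<le> 1 * norm (complex_of_real (\<theta> h) ^ 3)"
      by (simp add: norm_mult norm_power)
    finally show "norm (T h) \<le> 1 * norm (complex_of_real (\<theta> h) ^ 3)" .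
  qed
  then have T: "T \<in> o[at 0](\<lambda>h. of_real (norm h) ^ 2)"
    using landau_o.big_power[OF \<theta>, of 3] by (intro bigo_cube_imp_smallo_square) (rule landau_o.big_trans)
  have "(\<lambda>h. T h - \<i> * (of_real (\<theta> h) - \<alpha> h - \<beta> h) - 1 / 2 * ((of_real (\<theta> h) - \<alpha> h) * (of_real (\<theta> h) + \<alpha> h)))
      \<in> o[at 0](\<lambda>h. of_real (norm h) ^ 2)"
    using T r sq by (intro sum_in_smallo) simp_all
  also have "(\<lambda>h. T h - \<i> * (of_real (\<theta> h) - \<alpha> h - \<beta> h) - 1 / 2 * ((of_real (\<theta> h) - \<alpha> h) * (of_real (\<theta> h) + \<alpha> h)))
      = (\<lambda>h. exp (- \<i> * of_real (\<theta> h)) - (1 - \<i> * \<alpha> h - \<i> * \<beta> h - (\<alpha> h)\<^sup>2 / 2))"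
    by (auto simp: fun_eq_iff T_def field_simps power2_eq_square)
  finally show "(\<lambda>h. exp (- \<i> * of_real (\<theta> h)) - (1 - \<i> * \<alpha> h - \<i> * \<beta> h - (\<alpha> h)\<^sup>2 / 2)) \<in> o[at 0](\<lambda>h. of_real (norm h) ^ 2)" .
qed

text \<open>
  Product of the expansions of the phase and of \<open>u\<close>, discarding terms of order three. The first-order part is
  the covariant derivative of \<open>u\<close> in direction \<open>h\<close>; the coefficients \<open>c\<close> of the second-order part collect the Hessian
  of \<open>u\<close>, the mixed term, the derivative of \<open>A\<close> and the square of \<open>A\<close>.
\<close>

lemma gauge_translate_expansion:
  fixes A A' :: "'a::euclidean_space \<Rightarrow> 'a" and u :: "'a \<Rightarrow> complex" and d :: "'a \<Rightarrow> 'a \<Rightarrow> complex"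
  assumes A: "(A has_derivative A') (at x)"
    and du: "\<And>y. (u has_derivative (\<lambda>v. \<Sum>b\<in>Basis. of_real (v \<bullet> b) * d b y)) (at y)"
    and dd: "\<And>b. b \<in> Basis \<Longrightarrow> (d b has_derivative dd b) (at x)"
  defines "c \<equiv> \<lambda>a b. dd b a / 2 - \<i> * (of_real (a \<bullet> A x) * d b x)
      - (\<i> * of_real (a \<bullet> A' b) / 2 + of_real ((a \<bullet> A x) * (b \<bullet> A x)) / 2) * u x"
  shows "(\<lambda>h. exp (- \<i> * of_real (h \<bullet> A (x + h /\<^sub>R 2))) * u (x + h)
      - (u x + ((\<Sum>b\<in>Basis. of_real (h \<bullet> b) * d b x) - \<i> * of_real (h \<bullet> A x) * u x) + quad_form c h))
    \<in> o[at 0](\<lambda>h. of_real (norm h) ^ 2)"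
proof -
  define E where "E h = exp (- \<i> * complex_of_real (h \<bullet> A (x + h /\<^sub>R 2)))" for h
  define \<alpha> where "\<alpha> h = complex_of_real (h \<bullet> A x)" for h
  define \<beta> where "\<beta> h = complex_of_real (h \<bullet> A' h) / 2" for h
  define l where "l h = (\<Sum>b\<in>Basis. of_real (h \<bullet> b) * d b x)" for h
  define q where "q = quad_form (\<lambda>a b. dd b a / 2)"
  define P where "P h = 1 - \<i> * \<alpha> h - \<i> * \<beta> h - (\<alpha> h)\<^sup>2 / 2" for h
  have \<alpha>: "\<alpha> \<in> O[at 0](\<lambda>h. of_real (norm h))" and \<beta>: "\<beta> \<in> O[at 0](\<lambda>h. of_real (norm h) ^ 2)"
    and EP: "(\<lambda>h. E h - P h) \<in> o[at 0](\<lambda>h. of_real (norm h) ^ 2)"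
    using gauge_phase_expansion[OF A] unfolding E_def P_def \<alpha>_def \<beta>_def by simp_all
  have T: "(\<lambda>h. u (x + h) - (u x + l h + q h)) \<in> o[at 0](\<lambda>h. of_real (norm h) ^ 2)"
    unfolding l_def q_def by (rule second_order_taylor[OF du dd])
  have l: "l \<in> O[at 0](\<lambda>h. of_real (norm h))"
  proof (rule bigoI[of _ "\<Sum>b\<in>Basis. norm (d b x)"], intro always_eventually allI)
    fix h
    have "norm (l h) \<le> (\<Sum>b\<in>Basis. norm (d b x) * norm h)"
      unfolding l_def
      by (intro sum_norm_le) (auto simp: norm_mult mult.commute intro!: mult_right_mono Basis_le_norm)
    then show "norm (l h) \<le> (\<Sum>b\<in>Basis. norm (d b x)) * norm (complex_of_real (norm h))"
      by (simp add: sum_distrib_right)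
  qed
  have q: "q \<in> O[at 0](\<lambda>h. of_real (norm h) ^ 2)"
    unfolding q_def
    by (rule bigoI[of _ "\<Sum>a\<in>Basis. \<Sum>b\<in>Basis. norm (dd b a / 2)"], intro always_eventually allI, rule order_trans[OF norm_quad_form_le]) (simp add: norm_power)
  have const: "(\<lambda>_. k) \<in> O[at 0](\<lambda>_::'a. 1::complex)" for k :: complex
    by (rule bigoI[of _ "norm k"]) simp
  have N1: "(\<lambda>h::'a. complex_of_real (norm h)) \<in> O[at 0](\<lambda>_. 1)"
  proof (rule bigoI[of _ 1])
    have "\<forall>\<^sub>F h::'a in at 0. norm h < 1"
      by (auto simp: eventually_at intro!: exI[of _ 1])
    then show "\<forall>\<^sub>F h::'a in at 0. norm (complex_of_real (norm h)) \<le> 1 * norm (1::complex)"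
      by eventually_elim simp
  qed
  have poly: "(\<lambda>h. u x + l h + q h) \<in> O[at 0](\<lambda>_. 1)"
    by (intro sum_in_bigo const landau_o.big_trans[OF l N1] landau_o.big_trans[OF bigo_square_imp_bigo[OF q] N1])
  have E1: "E \<in> O[at 0](\<lambda>_. 1)"
    by (rule bigoI[of _ 1]) (simp add: E_def)
  have 1: "(\<lambda>h. E h * (u (x + h) - (u x + l h + q h))) \<in> o[at 0](\<lambda>h. of_real (norm h) ^ 2)"
    using landau_o.big_small_mult[OF E1 T] by simp
  have 2: "(\<lambda>h. (E h - P h) * (u x + l h + q h)) \<in> o[at 0](\<lambda>h. of_real (norm h) ^ 2)"
    using landau_o.small_big_mult[OF EP poly] by simp
  have \<gamma>: "(\<lambda>h. \<i> * \<beta> h + (\<alpha> h)\<^sup>2 / 2) \<in> O[at 0](\<lambda>h. of_real (norm h) ^ 2)"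
    using \<beta> landau_o.big_power[OF \<alpha>, of 2] by (intro sum_in_bigo) simp_all
  have lq: "(\<lambda>h. l h + q h) \<in> O[at 0](\<lambda>h. of_real (norm h))"
    by (intro sum_in_bigo l bigo_square_imp_bigo[OF q])
  have 3: "(\<lambda>h. (\<i> * \<beta> h + (\<alpha> h)\<^sup>2 / 2) * (l h + q h)) \<in> o[at 0](\<lambda>h. of_real (norm h) ^ 2)"
    using landau_o.big_mult[OF \<gamma> lq]
    by (intro bigo_cube_imp_smallo_square) (simp add: power2_eq_square power3_eq_cube)
  have 4: "(\<lambda>h. \<i> * (\<alpha> h * q h)) \<in> o[at 0](\<lambda>h. of_real (norm h) ^ 2)"
    using landau_o.big_mult[OF \<alpha> q]
    by (intro bigo_cube_imp_smallo_square) (simp add: power2_eq_square power3_eq_cube mult_ac)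
  have c: "quad_form c h = q h - \<i> * (\<alpha> h * l h) - (\<i> * \<beta> h + (\<alpha> h)\<^sup>2 / 2) * u x" for h
  proof -
    have \<alpha>': "\<alpha> h = (\<Sum>a\<in>Basis. of_real (h \<bullet> a) * of_real (a \<bullet> A x))"
      unfolding \<alpha>_def euclidean_inner[of h "A x"] by (simp add: inner_commute)
    have al: "\<alpha> h * l h = (\<Sum>a\<in>Basis. \<Sum>b\<in>Basis. of_real ((h \<bullet> a) * (h \<bullet> b)) * (of_real (a \<bullet> A x) * d b x))"
      unfolding \<alpha>' l_def sum_product by (intro sum.cong refl) simp
    have aa: "(\<alpha> h)\<^sup>2 = (\<Sum>a\<in>Basis. \<Sum>b\<in>Basis. of_real ((h \<bullet> a) * (h \<bullet> b)) * of_real ((a \<bullet> A x) * (b \<bullet> A x)))"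
      unfolding power2_eq_square \<alpha>' sum_product by (intro sum.cong refl) simp
    have lin: "linear A'" using A by (rule has_derivative_linear)
    have "A' h = (\<Sum>b\<in>Basis. (h \<bullet> b) *\<^sub>R A' b)"
      by (subst euclidean_representation[of h, symmetric]) (simp add: linear_sum[OF lin] linear_cmul[OF lin])
    then have inner_A': "A' h \<bullet> a = (\<Sum>b\<in>Basis. (h \<bullet> b) * (a \<bullet> A' b))" for a
      by (simp add: inner_sum_left inner_commute[of a])
    have "h \<bullet> A' h = (\<Sum>a\<in>Basis. \<Sum>b\<in>Basis. (h \<bullet> a) * (h \<bullet> b) * (a \<bullet> A' b))"
      unfolding euclidean_inner[of h "A' h"]
      by (simp add: inner_A' sum_distrib_left mult.assoc)
    then have bb: "\<beta> h = (\<Sum>a\<in>Basis. \<Sum>b\<in>Basis. of_real ((h \<bullet> a) * (h \<bullet> b)) * of_real (a \<bullet> A' b)) / 2"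
      unfolding \<beta>_def by simp
    show ?thesis
      unfolding al aa bb q_def quad_form_def c_def
      by (simp add: sum_subtractf sum.distrib sum_distrib_left sum_distrib_right sum_divide_distrib algebra_simps)
  qed
  have "(\<lambda>h. E h * (u (x + h) - (u x + l h + q h)) + (E h - P h) * (u x + l h + q h)
      - (\<i> * \<beta> h + (\<alpha> h)\<^sup>2 / 2) * (l h + q h) - \<i> * (\<alpha> h * q h)) \<in> o[at 0](\<lambda>h. of_real (norm h) ^ 2)"
    by (intro sum_in_smallo 1 2 3 4)
  also have "(\<lambda>h. E h * (u (x + h) - (u x + l h + q h)) + (E h - P h) * (u x + l h + q h)
      - (\<i> * \<beta> h + (\<alpha> h)\<^sup>2 / 2) * (l h + q h) - \<i> * (\<alpha> h * q h))
      = (\<lambda>h. E h * u (x + h) - (u x + (l h - \<i> * \<alpha> h * u x) + quad_form c h))"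
    unfolding c P_def by (auto simp: fun_eq_iff algebra_simps)
  finally show ?thesis unfolding E_def l_def \<alpha>_def .
qed

section \<open>Convergence to the magnetic Laplacian\<close>

lemma Ck_imp_continuous: "Ck k f \<Longrightarrow> continuous_on UNIV f"
  by (cases k) (auto intro!: continuous_at_imp_continuous_on differentiable_imp_continuous_within)

lemma Ck_SucD: "Ck (Suc k) f \<Longrightarrow> Ck k f"
proof (induction k arbitrary: f)
  case 0
  then show ?case using Ck_imp_continuous[of "Suc 0" f] by simp
next
  case (Suc k)
  then show ?case by (metis Ck.simps(2))
qed

lemma test_function_bounded:
  assumes "test_function u"
  obtains B where "\<And>y. norm (u y) \<le> B"
proof -
  let ?S = "closure {x. u x \<noteq> 0}"
  have "continuous_on UNIV u" and S: "compact ?S"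
    using assms Ck_imp_continuous[of 0 u] by (auto simp: test_function_def)
  then have "compact (u ` ?S)"
    by (intro compact_continuous_image) (auto intro: continuous_on_subset)
  then have "bounded (u ` ?S)" by (rule compact_imp_bounded)
  then obtain B where B: "\<And>y. y \<in> ?S \<Longrightarrow> norm (u y) \<le> B"
    unfolding bounded_iff by blast
  have "norm (u y) \<le> max B 0" for y
  proof (cases "u y = 0")
    case False
    then have "y \<in> ?S" using closure_subset[of "{x. u x \<noteq> 0}"] by blast
    from B[OF this] show ?thesis by simp
  qed simp
  then show thesis by (rule that)
qed

lemma sum_Basis_vec:
  fixes g :: "real^'n::finite \<Rightarrow> 'b::comm_monoid_add"
  shows "(\<Sum>b\<in>Basis. g b) = (\<Sum>j\<in>UNIV. g (axis j 1))"
proof -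
  have B: "(Basis :: (real^'n) set) = range (\<lambda>j. axis j 1)"
    by (auto simp: Basis_vec_def)
  have inj: "inj (\<lambda>j::'n. axis j (1::real))"
    by (auto simp: inj_def axis_eq_axis)
  show ?thesis
    unfolding B sum.reindex[OF inj] o_def ..
qed

lemma integral_lborel_translate:
  fixes x :: "'a::euclidean_space" and g :: "'a \<Rightarrow> 'b::{banach, second_countable_topology}"
  assumes "g \<in> borel_measurable borel"
  shows "(LINT y|lborel. g y) = (LINT h|lborel. g (x + h))"
proof -
  have "(LINT y|lborel. g y) = (LINT y|distr lborel borel ((+) x). g y)"
    by (simp only: lborel_distr_plus)
  also have "\<dots> = (LINT h|lborel. g (x + h))"
    using assms by (intro integral_distr) auto
  finally show ?thesis .
qed

text \<open>
  The value of \<open>u\<close> at \<open>x + h\<close>, transported back to \<open>x\<close> by the magnetic phase; this is the second term in the numerator of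
  the singular integral after the substitution \<open>y = x + h\<close>.
\<close>

definition gauge_translate :: "('a::euclidean_space \<Rightarrow> 'a) \<Rightarrow> ('a \<Rightarrow> complex) \<Rightarrow> 'a \<Rightarrow> 'a \<Rightarrow> complex" where
  "gauge_translate A u x h = exp (- \<i> * of_real (h \<bullet> A (x + h /\<^sub>R 2))) * u (x + h)"

text \<open>
  The even part in \<open>h\<close> of the numerator of the singular integral.
\<close>

definition gauge_defect :: "('a::euclidean_space \<Rightarrow> 'a) \<Rightarrow> ('a \<Rightarrow> complex) \<Rightarrow> 'a \<Rightarrow> 'a \<Rightarrow> complex" where
  "gauge_defect A u x h = u x - (gauge_translate A u x h + gauge_translate A u x (- h)) / 2"

lemma gauge_translate_0 [simp]: "gauge_translate A u x 0 = u x"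
  by (simp add: gauge_translate_def)

lemma norm_gauge_translate: "norm (gauge_translate A u x h) = norm (u (x + h))"
  by (simp add: gauge_translate_def norm_mult)

lemma measurable_gauge_translate:
  assumes "continuous_on UNIV A" "continuous_on UNIV u"
  shows "gauge_translate A u x \<in> borel_measurable borel"
  unfolding gauge_translate_def[abs_def]
  by (intro borel_measurable_continuous_onI continuous_intros
      continuous_on_compose2[OF assms(1)] continuous_on_compose2[OF assms(2)]) auto

text \<open>
  With the numerator symmetrised, the principal value in the operator becomes an absolutely convergent integral,
  in which the limit \<open>s \<rightarrow> 1\<close> can be analysed.
\<close>

lemma frac_magnetic_eq_integral:
  fixes A :: "real^3 \<Rightarrow> real^3" and u :: "real^3 \<Rightarrow> complex"
  assumes s: "0 < s" "s < 1" and m: "m > 0"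
    and cont: "continuous_on UNIV A" "continuous_on UNIV u"
    and B: "\<And>y. norm (u y) \<le> B" and C: "\<And>h. norm (gauge_defect A u x h) \<le> C * (norm h)\<^sup>2"
  shows "frac_magnetic s m A u x
    = (LINT h|lborel. gauge_defect A u x h * of_real (frac_kernel m s h)) + of_real (m powr (2 * s)) * u x"
proof -
  interpret radial_kernel "frac_kernel m s" by (rule radial_kernel_frac_kernel[OF s m])
  define \<nu> where "\<nu> = (3 + 2 * s) / 2"
  define c where "c = C_const s * m powr \<nu>"
  define g where "g y = (u x - exp (\<i> * complex_of_real ((x - y) \<bullet> A ((1 / 2) *\<^sub>R (x + y)))) * u y)
           / complex_of_real (norm (x - y) powr \<nu>) * complex_of_real (bessel_K \<nu> (m * norm (x - y)))" for y
  let ?f = "gauge_translate A u x"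
  have "Gamma (1 - s) > 0" using s by (intro Gamma_real_pos) simp
  then have c: "c > 0"
    using s m by (simp add: c_def C_const_def)
  have [measurable]: "A \<in> borel_measurable borel" "u \<in> borel_measurable borel"
    by (rule borel_measurable_continuous_onI[OF cont(1)], rule borel_measurable_continuous_onI[OF cont(2)])
  have f: "?f \<in> borel_measurable borel"
    by (rule measurable_gauge_translate[OF cont])
  have g [measurable]: "g \<in> borel_measurable borel"
  proof -
    have "(\<lambda>y. u x - exp (\<i> * complex_of_real ((x - y) \<bullet> A ((1 / 2) *\<^sub>R (x + y)))) * u y) \<in> borel_measurable borel"
      by (intro borel_measurable_continuous_onI continuous_intros cont(2)
          continuous_on_compose2[OF cont(1)]) auto
    then show ?thesis
      unfolding g_def[abs_def] by measurable
  qed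
  have gf: "of_real c * g (x + h) = (?f 0 - ?f h) * of_real (frac_kernel m s h)" for h
  proof -
    have "x + (x + h) = 2 *\<^sub>R x + h" by (simp add: scaleR_2)
    then have "(1 / 2) *\<^sub>R (x + (x + h)) = x + h /\<^sub>R 2"
      by (simp only: scaleR_add_right scaleR_scaleR) (simp add: inverse_eq_divide)
    then have "g (x + h) = (?f 0 - ?f h) / of_real (norm h powr \<nu>) * of_real (bessel_K \<nu> (m * norm h))"
      by (simp add: g_def gauge_translate_def)
    then show ?thesis
      unfolding frac_kernel_def \<nu>_def[symmetric] c_def[symmetric] by simp
  qed
  have trunc: "of_real c * (LINT y:{y. \<epsilon> \<le> norm (x - y)}|lborel. g y)
      = (LINT h:{h. \<epsilon> \<le> norm h}|lborel. (?f 0 - ?f h) * of_real (frac_kernel m s h))" for \<epsilon>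
  proof -
    have "(LINT y:{y. \<epsilon> \<le> norm (x - y)}|lborel. g y)
        = (LINT h|lborel. indicat_real {y. \<epsilon> \<le> norm (x - y)} (x + h) *\<^sub>R g (x + h))"
      unfolding set_lebesgue_integral_def by (rule integral_lborel_translate) measurable
    also have "\<dots> = (LINT h|lborel. indicat_real {h. \<epsilon> \<le> norm h} h *\<^sub>R g (x + h))"
      by (simp add: indicator_def)
    finally have "of_real c * (LINT y:{y. \<epsilon> \<le> norm (x - y)}|lborel. g y)
        = of_real c * (LINT h|lborel. indicat_real {h. \<epsilon> \<le> norm h} h *\<^sub>R g (x + h))"
      by (rule arg_cong)
    also have "\<dots> = (LINT h|lborel. of_real c * (indicat_real {h. \<epsilon> \<le> norm h} h *\<^sub>R g (x + h)))"
      by (rule integral_mult_right_zero[symmetric])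
    also have "\<dots> = (LINT h:{h. \<epsilon> \<le> norm h}|lborel. (?f 0 - ?f h) * of_real (frac_kernel m s h))"
      unfolding set_lebesgue_integral_def gf[symmetric] mult_scaleR_right ..
    finally show ?thesis .
  qed
  have "((\<lambda>\<epsilon>. LINT h:{h. \<epsilon> \<le> norm h}|lborel. (?f 0 - ?f h) * of_real (frac_kernel m s h))
      \<longlongrightarrow> (LINT h|lborel. (?f 0 - (?f h + ?f (- h)) / 2) * of_real (frac_kernel m s h))) (at_right 0)"
    by (rule symmetrised_principal_value[OF f, of B C])
      (use B C in \<open>simp_all add: norm_gauge_translate gauge_defect_def\<close>)
  then have "((\<lambda>\<epsilon>. of_real c * (LINT y:{y. \<epsilon> \<le> norm (x - y)}|lborel. g y) / of_real c)
      \<longlongrightarrow> (LINT h|lborel. gauge_defect A u x h * of_real (frac_kernel m s h)) / of_real c) (at_right 0)"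
    unfolding trunc by (intro tendsto_divide tendsto_const) (use c in \<open>simp_all add: gauge_defect_def\<close>)
  then have "((\<lambda>\<epsilon>. LINT y:{y. \<epsilon> \<le> norm (x - y)}|lborel. g y)
      \<longlongrightarrow> (LINT h|lborel. gauge_defect A u x h * of_real (frac_kernel m s h)) / of_real c) (at_right 0)"
    using c by simp
  then have "Lim (at_right 0) (\<lambda>\<epsilon>. LINT y:{y. \<epsilon> \<le> norm (x - y)}|lborel. g y)
      = (LINT h|lborel. gauge_defect A u x h * of_real (frac_kernel m s h)) / of_real c"
    by (intro tendsto_Lim) simp
  then show ?thesis
    using c unfolding frac_magnetic_def \<nu>_def[symmetric] c_def[symmetric] g_def[symmetric] by simp
qed

text \<open>
  Twice the diagonal of the coefficients found above agrees, coordinate by coordinate, with the expanded form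
  of the magnetic Laplacian.
\<close>

lemma gauge_defect_expansion:
  fixes A :: "real^3 \<Rightarrow> real^3" and u :: "real^3 \<Rightarrow> complex"
  assumes A: "Ck 1 A" and u: "Ck 2 u"
  obtains c where
    "(\<lambda>h. gauge_defect A u x h + quad_form c h) \<in> o[at 0](\<lambda>h. of_real (norm h) ^ 2)"
    "2 * (\<Sum>b\<in>Basis. c b b) = magnetic_laplacian A u x"
proof -
  define d where "d b y = frechet_derivative u (at y) b" for b y
  define dd where "dd b = frechet_derivative (d b) (at x)" for b
  define A' where "A' = frechet_derivative A (at x)"
  define c where "c a b = dd b a / 2 - \<i> * (of_real (a \<bullet> A x) * d b x)
      - (\<i> * of_real (a \<bullet> A' b) / 2 + of_real ((a \<bullet> A x) * (b \<bullet> A x)) / 2) * u x" for a b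
  have A': "(A has_derivative A') (at x)"
    unfolding A'_def using A by (simp add: frechet_derivative_works)
  have du: "(u has_derivative (\<lambda>v. \<Sum>b\<in>Basis. of_real (v \<bullet> b) * d b y)) (at y)" for y
  proof -
    have D: "(u has_derivative frechet_derivative u (at y)) (at y)"
      using u by (simp add: frechet_derivative_works numeral_2_eq_2)
    then have lin: "linear (frechet_derivative u (at y))" by (rule has_derivative_linear)
    have "frechet_derivative u (at y) = (\<lambda>v. \<Sum>b\<in>Basis. of_real (v \<bullet> b) * d b y)"
    proof
      fix v
      show "frechet_derivative u (at y) v = (\<Sum>b\<in>Basis. of_real (v \<bullet> b) * d b y)"
        unfolding d_def
        by (subst euclidean_representation[of v, symmetric])
          (simp only: linear_sum[OF lin] linear_cmul[OF lin], simp add: scaleR_conv_of_real)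
    qed
    with D show ?thesis by simp
  qed
  have dd: "(d b has_derivative dd b) (at x)" for b
    using u unfolding dd_def d_def frechet_derivative_works[symmetric] by (simp add: numeral_2_eq_2)
  have "(\<lambda>h. gauge_translate A u x h - (gauge_translate A u x 0
      + ((\<Sum>b\<in>Basis. of_real (h \<bullet> b) * d b x) - \<i> * of_real (h \<bullet> A x) * u x) + quad_form c h))
    \<in> o[at 0](\<lambda>h. of_real (norm h) ^ 2)"
    using gauge_translate_expansion[OF A' du dd] unfolding gauge_translate_def c_def by simp
  then have "(\<lambda>h. (gauge_translate A u x 0 - (gauge_translate A u x h + gauge_translate A u x (- h)) / 2) + quad_form c h)
      \<in> o[at 0](\<lambda>h. of_real (norm h) ^ 2)"
    by (rule symmetrised_expansion) (simp_all add: sum_negf quad_form_def)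
  then have 1: "(\<lambda>h. gauge_defect A u x h + quad_form c h) \<in> o[at 0](\<lambda>h. of_real (norm h) ^ 2)"
    by (simp add: gauge_defect_def)
  have dA: "partial_deriv j (\<lambda>y. A y $ j) x = A' (axis j 1) $ j" for j
    by (rule partial_deriv_eq[OF bounded_linear.has_derivative[OF bounded_linear_vec_nth A']])
  have nrm: "complex_of_real ((norm (A x))\<^sup>2) = (\<Sum>j\<in>UNIV. complex_of_real (A x $ j) * complex_of_real (A x $ j))"
    by (simp add: power2_norm_eq_inner inner_vec_def)
  have p1: "partial_deriv j u = d (axis j 1)" for j
    by (simp add: fun_eq_iff partial_deriv_def d_def)
  have p2: "partial_deriv j (d (axis j 1)) x = dd (axis j 1) (axis j 1)" for j
    by (simp add: partial_deriv_def dd_def)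
  have cj: "2 * c (axis j 1) (axis j 1) = dd (axis j 1) (axis j 1) - \<i> * u x * of_real (A' (axis j 1) $ j)
      - 2 * \<i> * (of_real (A x $ j) * d (axis j 1) x) - of_real (A x $ j) * of_real (A x $ j) * u x" for j
    by (simp add: c_def inner_axis' field_simps)
  have "2 * (\<Sum>b\<in>Basis. c b b) = (\<Sum>j\<in>UNIV. 2 * c (axis j 1) (axis j 1))"
    by (simp only: sum_Basis_vec sum_distrib_left)
  also have "\<dots> = (\<Sum>j\<in>UNIV. dd (axis j 1) (axis j 1)) - \<i> * u x * of_real (\<Sum>j\<in>UNIV. A' (axis j 1) $ j)
      - 2 * \<i> * (\<Sum>j\<in>UNIV. of_real (A x $ j) * d (axis j 1) x)
      - (\<Sum>j\<in>UNIV. of_real (A x $ j) * of_real (A x $ j)) * u x"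
    by (simp only: cj sum_subtractf sum_distrib_left sum_distrib_right of_real_sum)
  also have "\<dots> = - (- magnetic_laplacian A u x)"
    unfolding magnetic_laplacian_expand[OF A u] dA nrm p1 p2 by simp
  finally show thesis using that[OF 1] by simp
qed

theorem theorem1p5:
  fixes A :: "real^3 \<Rightarrow> real^3" and m :: real and u :: "real^3 \<Rightarrow> complex"
  assumes "Ck 2 A" and "m > 0" and "test_function u"
  shows "\<forall>x. ((\<lambda>s. frac_magnetic s m A u x) \<longlongrightarrow>
              - magnetic_laplacian A u x + complex_of_real (m\<^sup>2) * u x) (at_left 1)"
proof
  fix x
  have A1: "Ck 1 A" using assms(1) Ck_SucD[of 1 A] by (simp add: numeral_2_eq_2)
  have u2: "Ck 2 u" using assms(3) by (simp add: test_function_def)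
  have cont: "continuous_on UNIV A" "continuous_on UNIV u"
    using Ck_imp_continuous assms(1) u2 by blast+
  obtain B where B: "\<And>y. norm (u y) \<le> B" using test_function_bounded[OF assms(3)] by blast
  obtain c where c: "(\<lambda>h. gauge_defect A u x h + quad_form c h) \<in> o[at 0](\<lambda>h. of_real (norm h) ^ 2)"
    and trace: "2 * (\<Sum>b\<in>Basis. c b b) = magnetic_laplacian A u x"
    using gauge_defect_expansion[OF A1 u2] .
  have [measurable]: "gauge_translate A u x \<in> borel_measurable borel"
    by (rule measurable_gauge_translate[OF cont])
  have meas: "gauge_defect A u x \<in> borel_measurable borel"
    unfolding gauge_defect_def[abs_def] by measurable
  have zero: "gauge_defect A u x 0 = 0" by (simp add: gauge_defect_def)
  have bdd: "norm (gauge_defect A u x h) \<le> 2 * B" for h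
  proof -
    have "norm (gauge_translate A u x h + gauge_translate A u x (- h)) \<le> B + B"
      by (intro order_trans[OF norm_triangle_ineq] add_mono) (simp_all add: norm_gauge_translate B)
    then have "norm ((gauge_translate A u x h + gauge_translate A u x (- h)) / 2) \<le> B"
      by (simp add: norm_divide)
    then show ?thesis
      unfolding gauge_defect_def
      using norm_triangle_ineq4[of "u x" "(gauge_translate A u x h + gauge_translate A u x (- h)) / 2"] B[of x]
      by linarith
  qed
  obtain C where C: "\<And>h. norm (gauge_defect A u x h) \<le> C * (norm h)\<^sup>2"
    using quadratic_expansion_imp_quadratic_bound[OF c zero bdd] by blast
  have "\<forall>\<^sub>F s in at_left 1. s \<in> {0<..<1::real}"
    by (rule eventually_at_left_real) simp
  then have "\<forall>\<^sub>F s in at_left 1. frac_magnetic s m A u x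
      = (LINT h|lborel. gauge_defect A u x h * of_real (frac_kernel m s h)) + of_real (m powr (2 * s)) * u x"
    by eventually_elim (auto intro!: frac_magnetic_eq_integral assms(2) cont B C)
  moreover have "((\<lambda>s. (LINT h|lborel. gauge_defect A u x h * of_real (frac_kernel m s h)) + of_real (m powr (2 * s)) * u x)
      \<longlongrightarrow> - (2 * (\<Sum>b\<in>Basis. c b b)) + of_real (m powr (2 * 1)) * u x) (at_left 1)"
    using assms(2) by (intro tendsto_intros tendsto_integral_frac_kernel[OF assms(2) meas zero bdd c]) auto
  ultimately show "((\<lambda>s. frac_magnetic s m A u x) \<longlongrightarrow>
      - magnetic_laplacian A u x + complex_of_real (m\<^sup>2) * u x) (at_left 1)"
    using assms(2) by (simp add: trace tendsto_cong)
qed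

end
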